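(* Let $(R,\mathfrak m)$ be a commutative noetherian local ring, $I$ an ideal of $R$, and let $\mathcal S$ be the class of all $I^\circ$-cogenerated $R$-modules. If $N$ is an injective $R$-module, then $$N\in\mathcal S\iff I_{\mathfrak p}\cong R_{\mathfrak p}\text{ for all }\mathfrak p\in\operatorname{Ass}(N).$$
   Context: $E$ is the injective hull of the residue field $R/\mathfrak m$, and $I^\circ=\operatorname{Hom}_R(I,E)$. An $R$-module $N$ is $I^\circ$-cogenerated if there is a monomorphism $N\hookrightarrow (I^\circ)^\Lambda$ for some index set $\Lambda$ (direct product of copies of $I^\circ$). $I_{\mathfrak p}=IR_{\mathfrak p}$, and $I_{\mathfrak p}\cong R_{\mathfrak p}$ means isomorphism of $R_{\mathfrak p}$-modules. $\operatorname{Ass}(N)$ is the set of associated primes of $N$, i.e. prime ideals of the form $\operatorname{Ann}_R(x)$ with $x\in N$. *)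

theory Defs
  imports "HOL-Algebra.Ring_Divisibility" "HOL-Algebra.Module"
begin

section \<open>Modules and their homomorphisms\<close>

text \<open>
  Rings and modules are the carrier-based structures of HOL-Algebra. In the record type
  \<^typ>\<open>('r, 'n) module\<close> the fields \<^const>\<open>mult\<close> and \<^const>\<open>one\<close> of the underlying \<^typ>\<open>'n ring\<close>
  play no role for modules; where a module has no natural multiplication they are filled
  with \<^const>\<open>undefined\<close>.
\<close>

definition module_hom ::
    "('r, 'x) ring_scheme \<Rightarrow> ('r, 'm, 'y) module_scheme \<Rightarrow> ('r, 'n, 'z) module_scheme \<Rightarrow> ('m \<Rightarrow> 'n) set"
  where "module_hom R M N =
    {f \<in> carrier M \<rightarrow> carrier N.
       (\<forall>x\<in>carrier M. \<forall>y\<in>carrier M. f (x \<oplus>\<^bsub>M\<^esub> y) = f x \<oplus>\<^bsub>N\<^esub> f y) \<and>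
       (\<forall>a\<in>carrier R. \<forall>x\<in>carrier M. f (a \<odot>\<^bsub>M\<^esub> x) = a \<odot>\<^bsub>N\<^esub> f x)}"

definition module_mono ::
    "('r, 'x) ring_scheme \<Rightarrow> ('r, 'm, 'y) module_scheme \<Rightarrow> ('r, 'n, 'z) module_scheme \<Rightarrow> ('m \<Rightarrow> 'n) set"
  where "module_mono R M N = {f \<in> module_hom R M N. inj_on f (carrier M)}"

definition module_iso ::
    "('r, 'x) ring_scheme \<Rightarrow> ('r, 'm, 'y) module_scheme \<Rightarrow> ('r, 'n, 'z) module_scheme \<Rightarrow> ('m \<Rightarrow> 'n) set"
  where "module_iso R M N = {f \<in> module_hom R M N. bij_betw f (carrier M) (carrier N)}"

definition modules_isomorphic ::
    "('r, 'x) ring_scheme \<Rightarrow> ('r, 'm, 'y) module_scheme \<Rightarrow> ('r, 'n, 'z) module_scheme \<Rightarrow> bool"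
  where "modules_isomorphic R M N \<longleftrightarrow> module_iso R M N \<noteq> {}"

definition ideal_module :: "('r, 'x) ring_scheme \<Rightarrow> 'r set \<Rightarrow> ('r, 'r) module"
  where "ideal_module R I =
    \<lparr>carrier = I, mult = mult R, one = one R, zero = zero R, add = add R, smult = mult R\<rparr>"

definition quotient_module :: "('r, 'x) ring_scheme \<Rightarrow> 'r set \<Rightarrow> ('r, 'r set) module"
  where "quotient_module R I =
    \<lparr>carrier = carrier (R Quot I), mult = mult (R Quot I), one = one (R Quot I),
     zero = zero (R Quot I), add = add (R Quot I),
     smult = (\<lambda>a X. (I +>\<^bsub>R\<^esub> a) \<otimes>\<^bsub>R Quot I\<^esub> X)\<rparr>"

text \<open>Homomorphisms are made extensional so that equality in the Hom module is equality on
  \<^term>\<open>carrier M\<close>.\<close>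

definition hom_module ::
    "('r, 'x) ring_scheme \<Rightarrow> ('r, 'm, 'y) module_scheme \<Rightarrow> ('r, 'n, 'z) module_scheme \<Rightarrow> ('r, 'm \<Rightarrow> 'n) module"
  where "hom_module R M N =
    \<lparr>carrier = module_hom R M N \<inter> extensional (carrier M),
     mult = undefined, one = undefined,
     zero = (\<lambda>x\<in>carrier M. \<zero>\<^bsub>N\<^esub>),
     add = (\<lambda>f g. \<lambda>x\<in>carrier M. f x \<oplus>\<^bsub>N\<^esub> g x),
     smult = (\<lambda>a f. \<lambda>x\<in>carrier M. a \<odot>\<^bsub>N\<^esub> f x)\<rparr>"

definition power_module :: "'l set \<Rightarrow> ('r, 'n, 'z) module_scheme \<Rightarrow> ('r, 'l \<Rightarrow> 'n) module"
  where "power_module L M =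
    \<lparr>carrier = L \<rightarrow>\<^sub>E carrier M,
     mult = undefined, one = undefined,
     zero = (\<lambda>i\<in>L. \<zero>\<^bsub>M\<^esub>),
     add = (\<lambda>f g. \<lambda>i\<in>L. f i \<oplus>\<^bsub>M\<^esub> g i),
     smult = (\<lambda>a f. \<lambda>i\<in>L. a \<odot>\<^bsub>M\<^esub> f i)\<rparr>"


section \<open>Injective modules, injective hulls, cogenerated modules\<close>

text \<open>
  HOL cannot quantify over all types inside a definition, so the test modules for injectivity
  and the index sets for cogeneration range over a type chosen by the parameter \<^typ>\<open>'u\<close>.
  No choice of \<^typ>\<open>'u\<close> distorts the notions: modules on \<^typ>\<open>'r + 'u\<close> include copies of \<^term>\<open>R\<close>
  and its ideals, which suffice by Baer's criterion, and a monomorphism of \<^term>\<open>N\<close> into some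
  power of \<^term>\<open>C\<close> yields one into a power indexed by a subset of the type of elements of
  \<^term>\<open>N\<close>, by selecting for each nonzero element one coordinate not vanishing on it.
\<close>

definition injective_module ::
    "'u itself \<Rightarrow> ('r, 'x) ring_scheme \<Rightarrow> ('r, 'n, 'z) module_scheme \<Rightarrow> bool"
  where "injective_module (_ :: 'u itself) R N \<longleftrightarrow>
    module R N \<and>
    (\<forall>(A :: ('r, 'r + 'u) module) (B :: ('r, 'r + 'u) module).
       module R A \<longrightarrow> module R B \<longrightarrow>
       (\<forall>i\<in>module_mono R A B. \<forall>f\<in>module_hom R A N.
          \<exists>g\<in>module_hom R B N. \<forall>x\<in>carrier A. g (i x) = f x))"

definition essential_submodule ::
    "'n set \<Rightarrow> ('r, 'x) ring_scheme \<Rightarrow> ('r, 'n, 'z) module_scheme \<Rightarrow> bool"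
  where "essential_submodule H R M \<longleftrightarrow>
    submodule H R M \<and>
    (\<forall>K. submodule K R M \<longrightarrow> H \<inter> K = {\<zero>\<^bsub>M\<^esub>} \<longrightarrow> K = {\<zero>\<^bsub>M\<^esub>})"

definition injective_hull ::
    "'u itself \<Rightarrow> ('r, 'x) ring_scheme \<Rightarrow> ('r, 'm, 'y) module_scheme \<Rightarrow> ('r, 'n, 'z) module_scheme \<Rightarrow> bool"
  where "injective_hull U R M E \<longleftrightarrow>
    injective_module U R E \<and>
    (\<exists>i\<in>module_mono R M E. essential_submodule (i ` carrier M) R E)"

definition cogenerated_class ::
    "'u itself \<Rightarrow> ('r, 'x) ring_scheme \<Rightarrow> ('r, 'c, 'y) module_scheme \<Rightarrow> ('r, 'n, 'z) module_scheme set"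
  where "cogenerated_class (_ :: 'u itself) R C =
    {N. module R N \<and> (\<exists>L :: ('n + 'u) set. module_mono R N (power_module L C) \<noteq> {})}"


section \<open>Local rings, annihilators, associated primes\<close>

definition local_ring :: "('r, 'x) ring_scheme \<Rightarrow> 'r set \<Rightarrow> bool"
  where "local_ring R \<mm> \<longleftrightarrow> cring R \<and> {J. maximalideal J R} = {\<mm>}"

definition annihilator :: "('r, 'x) ring_scheme \<Rightarrow> ('r, 'n, 'z) module_scheme \<Rightarrow> 'n \<Rightarrow> 'r set"
  where "annihilator R N x = {a \<in> carrier R. a \<odot>\<^bsub>N\<^esub> x = \<zero>\<^bsub>N\<^esub>}"

definition Ass :: "('r, 'x) ring_scheme \<Rightarrow> ('r, 'n, 'z) module_scheme \<Rightarrow> 'r set set"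
  where "Ass R N = {P. primeideal P R \<and> (\<exists>x\<in>carrier N. P = annihilator R N x)}"


section \<open>Localization at a prime ideal\<close>

definition frac_rel :: "('r, 'x) ring_scheme \<Rightarrow> 'r set \<Rightarrow> (('r \<times> 'r) \<times> ('r \<times> 'r)) set"
  where "frac_rel R P =
    {((a, s), (b, t)). a \<in> carrier R \<and> s \<in> carrier R - P \<and> b \<in> carrier R \<and> t \<in> carrier R - P \<and>
       (\<exists>u\<in>carrier R - P. u \<otimes>\<^bsub>R\<^esub> (a \<otimes>\<^bsub>R\<^esub> t) = u \<otimes>\<^bsub>R\<^esub> (b \<otimes>\<^bsub>R\<^esub> s))}"

definition loc_frac :: "('r, 'x) ring_scheme \<Rightarrow> 'r set \<Rightarrow> 'r \<Rightarrow> 'r \<Rightarrow> ('r \<times> 'r) set"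
  where "loc_frac R P a s = frac_rel R P `` {(a, s)}"

definition localization :: "('r, 'x) ring_scheme \<Rightarrow> 'r set \<Rightarrow> ('r \<times> 'r) set ring"
  where "localization R P =
    \<lparr>carrier = (carrier R \<times> (carrier R - P)) // frac_rel R P,
     mult = (\<lambda>X Y. \<Union>(a, s)\<in>X. \<Union>(b, t)\<in>Y. loc_frac R P (a \<otimes>\<^bsub>R\<^esub> b) (s \<otimes>\<^bsub>R\<^esub> t)),
     one = loc_frac R P \<one>\<^bsub>R\<^esub> \<one>\<^bsub>R\<^esub>,
     zero = loc_frac R P \<zero>\<^bsub>R\<^esub> \<one>\<^bsub>R\<^esub>,
     add = (\<lambda>X Y. \<Union>(a, s)\<in>X. \<Union>(b, t)\<in>Y.
              loc_frac R P (a \<otimes>\<^bsub>R\<^esub> t \<oplus>\<^bsub>R\<^esub> b \<otimes>\<^bsub>R\<^esub> s) (s \<otimes>\<^bsub>R\<^esub> t))\<rparr>"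

text \<open>The extension of an ideal \<^term>\<open>I\<close> along the canonical map to the localization at \<^term>\<open>P\<close>.\<close>

definition localized_ideal :: "('r, 'x) ring_scheme \<Rightarrow> 'r set \<Rightarrow> 'r set \<Rightarrow> ('r \<times> 'r) set set"
  where "localized_ideal R P I =
    Idl\<^bsub>localization R P\<^esub> ((\<lambda>a. loc_frac R P a \<one>\<^bsub>R\<^esub>) ` I)"

text \<open>The operations on fractions do not depend on representatives.\<close>

context primeideal
begin

lemma denom_one: "\<one> \<in> carrier R - I"
  using I_notcarr one_imp_carrier by blast

lemma denom_mult: "\<lbrakk>s \<in> carrier R - I; t \<in> carrier R - I\<rbrakk> \<Longrightarrow> s \<otimes> t \<in> carrier R - I"
  using I_prime by blast

lemma frac_rel_iff:
  "((a, s), (b, t)) \<in> frac_rel R I \<longleftrightarrow>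
     a \<in> carrier R \<and> s \<in> carrier R - I \<and> b \<in> carrier R \<and> t \<in> carrier R - I \<and>
     (\<exists>u\<in>carrier R - I. u \<otimes> (a \<otimes> t) = u \<otimes> (b \<otimes> s))"
  by (simp add: frac_rel_def)

lemma equiv_frac_rel: "equiv (carrier R \<times> (carrier R - I)) (frac_rel R I)"
proof (rule equivI)
  show "frac_rel R I \<subseteq> (carrier R \<times> (carrier R - I)) \<times> (carrier R \<times> (carrier R - I))"
    by (auto simp: frac_rel_def)
  show "refl_on (carrier R \<times> (carrier R - I)) (frac_rel R I)"
    using denom_one by (auto simp: refl_on_def frac_rel_def)
  show "sym (frac_rel R I)"
    unfolding sym_def frac_rel_def by clarsimp (metis DiffI)
  show "trans (frac_rel R I)"
  proof (rule transI, clarify)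
    fix a s b t c w
    assume 1: "((a, s), (b, t)) \<in> frac_rel R I" and 2: "((b, t), (c, w)) \<in> frac_rel R I"
    then obtain u v where u: "u \<in> carrier R - I" "u \<otimes> (a \<otimes> t) = u \<otimes> (b \<otimes> s)"
      and v: "v \<in> carrier R - I" "v \<otimes> (b \<otimes> w) = v \<otimes> (c \<otimes> t)"
      unfolding frac_rel_iff by blast
    note c = 1[unfolded frac_rel_iff] 2[unfolded frac_rel_iff]
    have "(u \<otimes> v \<otimes> t) \<otimes> (a \<otimes> w) = (v \<otimes> w) \<otimes> (u \<otimes> (a \<otimes> t))"
      using c u(1) v(1) by (simp add: m_ac)
    also have "\<dots> = (u \<otimes> s) \<otimes> (v \<otimes> (b \<otimes> w))"
      unfolding u(2) using c u(1) v(1) by (simp add: m_ac)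
    also have "\<dots> = (u \<otimes> v \<otimes> t) \<otimes> (c \<otimes> s)"
      unfolding v(2) using c u(1) v(1) by (simp add: m_ac)
    finally show "((a, s), (c, w)) \<in> frac_rel R I"
      unfolding frac_rel_iff using c denom_mult[OF denom_mult[OF u(1) v(1)], of t] by blast
  qed
qed

lemma frac_eq_iff:
  assumes "a \<in> carrier R" "s \<in> carrier R - I" "b \<in> carrier R" "t \<in> carrier R - I"
  shows "loc_frac R I a s = loc_frac R I b t \<longleftrightarrow>
    (\<exists>u\<in>carrier R - I. u \<otimes> (a \<otimes> t) = u \<otimes> (b \<otimes> s))"
  unfolding loc_frac_def
  using eq_equiv_class_iff[OF equiv_frac_rel, of "(a, s)" "(b, t)"] assms
  by (simp add: frac_rel_iff)

lemma carrier_localization: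
  "carrier (localization R I) = {loc_frac R I a s |a s. a \<in> carrier R \<and> s \<in> carrier R - I}"
  by (auto simp: localization_def quotient_def loc_frac_def)

lemma mult_frac:
  assumes "a \<in> carrier R" "s \<in> carrier R - I" "b \<in> carrier R" "t \<in> carrier R - I"
  shows "loc_frac R I a s \<otimes>\<^bsub>localization R I\<^esub> loc_frac R I b t = loc_frac R I (a \<otimes> b) (s \<otimes> t)"
proof -
  have "(\<lambda>(a, s) (b, t). loc_frac R I (a \<otimes> b) (s \<otimes> t)) respects2 frac_rel R I"
  proof (rule congruent2_commuteI[OF equiv_frac_rel], goal_cases)
    case (1 y z) then show ?case by (auto simp: m_comm)
  next
    case (2 y z w)
    obtain a s b t c w' where e: "y = (a, s)" "z = (b, t)" "w = (c, w')" by (cases y, cases z, cases w)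
    from 2(2) obtain u where c: "a \<in> carrier R" "s \<in> carrier R - I" "b \<in> carrier R" "t \<in> carrier R - I"
      and u: "u \<in> carrier R - I" "u \<otimes> (a \<otimes> t) = u \<otimes> (b \<otimes> s)"
      unfolding e frac_rel_iff by blast
    have w: "c \<in> carrier R" "w' \<in> carrier R - I" using 2(1) e by auto
    have "u \<otimes> (c \<otimes> a \<otimes> (w' \<otimes> t)) = (c \<otimes> w') \<otimes> (u \<otimes> (a \<otimes> t))"
      using c w u(1) by (simp add: m_ac)
    also have "\<dots> = u \<otimes> (c \<otimes> b \<otimes> (w' \<otimes> s))"
      unfolding u(2) using c w u(1) by (simp add: m_ac)
    finally have "loc_frac R I (c \<otimes> a) (w' \<otimes> s) = loc_frac R I (c \<otimes> b) (w' \<otimes> t)"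
      using c w u(1) denom_mult by (subst frac_eq_iff) auto
    then show ?case by (simp add: e)
  qed
  from UN_equiv_class2[OF equiv_frac_rel equiv_frac_rel this, of "(a, s)" "(b, t)"] assms
  show ?thesis by (simp add: localization_def loc_frac_def case_prod_unfold)
qed

lemma add_frac:
  assumes "a \<in> carrier R" "s \<in> carrier R - I" "b \<in> carrier R" "t \<in> carrier R - I"
  shows "loc_frac R I a s \<oplus>\<^bsub>localization R I\<^esub> loc_frac R I b t = loc_frac R I (a \<otimes> t \<oplus> b \<otimes> s) (s \<otimes> t)"
proof -
  have "(\<lambda>(a, s) (b, t). loc_frac R I (a \<otimes> t \<oplus> b \<otimes> s) (s \<otimes> t)) respects2 frac_rel R I"
  proof (rule congruent2_commuteI[OF equiv_frac_rel], goal_cases)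
    case (1 y z) then show ?case by (auto simp: m_comm a_comm)
  next
    case (2 y z w)
    obtain a s b t c w' where e: "y = (a, s)" "z = (b, t)" "w = (c, w')" by (cases y, cases z, cases w)
    from 2(2) obtain u where c: "a \<in> carrier R" "s \<in> carrier R - I" "b \<in> carrier R" "t \<in> carrier R - I"
      and u: "u \<in> carrier R - I" "u \<otimes> (a \<otimes> t) = u \<otimes> (b \<otimes> s)"
      unfolding e frac_rel_iff by blast
    have w: "c \<in> carrier R" "w' \<in> carrier R - I" using 2(1) e by auto
    have "u \<otimes> ((c \<otimes> s \<oplus> a \<otimes> w') \<otimes> (w' \<otimes> t)) =
        (w' \<otimes> w') \<otimes> (u \<otimes> (a \<otimes> t)) \<oplus> u \<otimes> c \<otimes> s \<otimes> w' \<otimes> t"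
      using c w u(1) by (simp add: m_ac a_ac l_distr r_distr)
    also have "\<dots> = u \<otimes> ((c \<otimes> t \<oplus> b \<otimes> w') \<otimes> (w' \<otimes> s))"
      unfolding u(2) using c w u(1) by (simp add: m_ac a_ac l_distr r_distr)
    finally have "loc_frac R I (c \<otimes> s \<oplus> a \<otimes> w') (w' \<otimes> s) = loc_frac R I (c \<otimes> t \<oplus> b \<otimes> w') (w' \<otimes> t)"
      using c w u(1) denom_mult by (subst frac_eq_iff) auto
    then show ?case by (simp add: e)
  qed
  from UN_equiv_class2[OF equiv_frac_rel equiv_frac_rel this, of "(a, s)" "(b, t)"] assms
  show ?thesis by (simp add: localization_def loc_frac_def case_prod_unfold)
qed

end

end

theory Submission
  imports Defs
begin

text \<open>
  A homomorphism \<^term>\<open>N\<close> to \<open>Hom(I, E)\<close> is the same thing as a bilinear pairing of \<^term>\<open>N\<close> and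
  \<^term>\<open>I\<close> with values in \<^term>\<open>E\<close>. Hence \<^term>\<open>N\<close> is cogenerated by \<open>Hom(I, E)\<close> if and only if every
  nonzero \<open>x\<close> in \<^term>\<open>N\<close> satisfies \<open>g(x, a) \<noteq> 0\<close> for some pairing \<open>g\<close> and some \<open>a\<close> in \<^term>\<open>I\<close>
  (\<open>cogenerated_class_hom_module_iff\<close>). On the other side, \<open>I\<^sub>P\<close> is isomorphic to \<open>R\<^sub>P\<close> if and only if some
  \<open>a\<close> in \<^term>\<open>I\<close> becomes a regular generator of \<open>I\<^sub>P\<close>: every \<open>b\<close> in \<^term>\<open>I\<close> has a multiple \<open>u b\<close> in \<open>R a\<close>
  with \<open>u \<notin> P\<close>, and every \<open>c\<close> with \<open>c a = 0\<close> is killed by some \<open>u \<notin> P\<close>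
  (\<open>localized_ideal_iso_iff\<close>). Both directions of the theorem turn such data for one side into data
  for the other, with the same \<open>a\<close>.

  Let \<open>P = ann(x)\<close> be associated to \<^term>\<open>N\<close> and \<open>g(x, a) \<noteq> 0\<close>. If some \<open>b\<close> in \<^term>\<open>I\<close> had no multiple
  \<open>u b\<close> in \<open>R a\<close> with \<open>u \<notin> P\<close>, then \<open>b \<mapsto> x, a \<mapsto> 0\<close> would define a homomorphism from \<open>R a + R b\<close> to
  \<^term>\<open>N\<close>, and injectivity of \<^term>\<open>N\<close> would yield \<open>y\<close> with \<open>b y = x\<close> and \<open>a y = 0\<close>. But then
  \<open>g(x, a) = g(y, b a) = g(a y, b) = 0\<close>. Similarly, \<open>c a = 0\<close> together with \<open>ann(c) \<subseteq> P\<close> gives \<open>y\<close> with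
  \<open>c y = x\<close>, so that \<open>g(x, a) = g(y, c a) = 0\<close> (\<open>pairing_imp_locally_free\<close>).

  Conversely, a nonzero element has a multiple \<open>y\<close> whose annihilator \<open>P\<close> is prime, as \<^term>\<open>R\<close> is
  noetherian, and it suffices to find a pairing that does not vanish at \<open>(y, a)\<close>. As \<^term>\<open>I\<close> is finitely
  generated, one \<open>u \<notin> P\<close> satisfies \<open>u I \<subseteq> R a\<close>. The pairing is \<open>g(x, b) = h(r x)\<close> for \<open>u b = r a\<close>,
  which is \<open>h(u (b/a) x)\<close> in the notation of fractions. The factor \<open>r\<close> is determined up to elements killed
  outside \<open>P\<close>, so \<open>g\<close> is well defined as soon as \<open>h\<close> vanishes on all elements of \<^term>\<open>N\<close> killed
  by some \<open>v \<notin> P\<close>; and \<open>g(y, a) = h(u y)\<close>. Such an \<open>h\<close> with \<open>h(u y) \<noteq> 0\<close> exists because \<^term>\<open>E\<close> is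
  injective and contains a nonzero element killed by the maximal ideal, hence by \<open>P\<close>
  (\<open>locally_free_imp_pairing\<close>).

  The domain of \<open>h\<close> is a module on the arbitrary type of \<^term>\<open>N\<close>, while injectivity speaks of modules on
  \<^typ>\<open>'r + 'u\<close> only; Baer's criterion bridges the gap (\<open>injective_module_extend_graph\<close>).
\<close>

section \<open>Ideals as modules, graphs of partial homomorphisms\<close>

lemma module_ideal_module:
  assumes "cring R" "ideal I R"
  shows "module R (ideal_module R I)"
proof -
  interpret R: cring R by fact
  interpret I: ideal I R by fact
  show ?thesis
  proof (rule moduleI[OF assms(1)])
    show "abelian_group (ideal_module R I)"
    proof (rule abelian_groupI)
      show "\<exists>y\<in>carrier (ideal_module R I). y \<oplus>\<^bsub>ideal_module R I\<^esub> x = \<zero>\<^bsub>ideal_module R I\<^esub>"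
        if "x \<in> carrier (ideal_module R I)" for x
        using that I.a_inv_closed[of x] by (auto simp: ideal_module_def R.l_neg intro!: bexI[of _ "\<ominus>\<^bsub>R\<^esub> x"])
    qed (auto simp: ideal_module_def R.a_assoc R.a_comm R.a_lcomm I.a_closed I.Icarr)
  qed (auto simp: ideal_module_def I.I_l_closed I.Icarr R.l_distr R.r_distr R.m_assoc)
qed

text \<open>
  The graph of a homomorphism into \<^term>\<open>N\<close> defined on a submodule of \<^term>\<open>M\<close>. Graphs of partial maps
  are ordered by inclusion and have unions as upper bounds of chains, which is what the maximality
  argument below needs; and a partial homomorphism such as \<open>r b + s a \<mapsto> r x\<close> can be written down before
  it is known to be single-valued. By linearity, single-valuedness is only required at \<open>0\<close>.
\<close>

definition linear_graph ::
    "('r, 'x) ring_scheme \<Rightarrow> ('r, 'm, 'y) module_scheme \<Rightarrow> ('r, 'n, 'z) module_scheme \<Rightarrow> ('m \<times> 'n) set \<Rightarrow> bool"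
  where "linear_graph R M N G \<longleftrightarrow>
    G \<subseteq> carrier M \<times> carrier N \<and> (\<zero>\<^bsub>M\<^esub>, \<zero>\<^bsub>N\<^esub>) \<in> G \<and>
    (\<forall>x y x' y'. (x, y) \<in> G \<longrightarrow> (x', y') \<in> G \<longrightarrow> (x \<oplus>\<^bsub>M\<^esub> x', y \<oplus>\<^bsub>N\<^esub> y') \<in> G) \<and>
    (\<forall>a\<in>carrier R. \<forall>x y. (x, y) \<in> G \<longrightarrow> (a \<odot>\<^bsub>M\<^esub> x, a \<odot>\<^bsub>N\<^esub> y) \<in> G) \<and>
    (\<forall>y. (\<zero>\<^bsub>M\<^esub>, y) \<in> G \<longrightarrow> y = \<zero>\<^bsub>N\<^esub>)"

lemma linear_graphD:
  assumes "linear_graph R M N G"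
  shows "(x, y) \<in> G \<Longrightarrow> x \<in> carrier M" "(x, y) \<in> G \<Longrightarrow> y \<in> carrier N"
    "(\<zero>\<^bsub>M\<^esub>, \<zero>\<^bsub>N\<^esub>) \<in> G"
    "(x, y) \<in> G \<Longrightarrow> (x', y') \<in> G \<Longrightarrow> (x \<oplus>\<^bsub>M\<^esub> x', y \<oplus>\<^bsub>N\<^esub> y') \<in> G"
    "a \<in> carrier R \<Longrightarrow> (x, y) \<in> G \<Longrightarrow> (a \<odot>\<^bsub>M\<^esub> x, a \<odot>\<^bsub>N\<^esub> y) \<in> G"
    "(\<zero>\<^bsub>M\<^esub>, y) \<in> G \<Longrightarrow> y = \<zero>\<^bsub>N\<^esub>"
  using assms unfolding linear_graph_def by blast+

lemma linear_graph_minus: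
  assumes M: "module R M" and N: "module R N" and G: "linear_graph R M N G" and xy: "(x, y) \<in> G"
  shows "(\<ominus>\<^bsub>M\<^esub> x, \<ominus>\<^bsub>N\<^esub> y) \<in> G"
proof -
  interpret M: module R M by fact
  interpret N: module R N by fact
  have "\<ominus>\<^bsub>M\<^esub> x = (\<ominus>\<^bsub>R\<^esub> \<one>\<^bsub>R\<^esub>) \<odot>\<^bsub>M\<^esub> x" "\<ominus>\<^bsub>N\<^esub> y = (\<ominus>\<^bsub>R\<^esub> \<one>\<^bsub>R\<^esub>) \<odot>\<^bsub>N\<^esub> y"
    using linear_graphD(1,2)[OF G xy] by (simp_all add: M.smult_l_minus N.smult_l_minus)
  then show ?thesis
    using linear_graphD(5)[OF G _ xy] M.R.add.inv_closed M.R.one_closed by metis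
qed

lemma linear_graph_unique:
  assumes M: "module R M" and N: "module R N" and G: "linear_graph R M N G"
    and xy: "(x, y) \<in> G" and xz: "(x, z) \<in> G"
  shows "y = z"
proof -
  interpret M: module R M by fact
  interpret N: module R N by fact
  note c = linear_graphD(1,2)[OF G xy] linear_graphD(2)[OF G xz]
  have "(x \<oplus>\<^bsub>M\<^esub> \<ominus>\<^bsub>M\<^esub> x, y \<oplus>\<^bsub>N\<^esub> \<ominus>\<^bsub>N\<^esub> z) \<in> G"
    using linear_graphD(4)[OF G xy linear_graph_minus[OF M N G xz]] .
  then have "y \<oplus>\<^bsub>N\<^esub> \<ominus>\<^bsub>N\<^esub> z = \<zero>\<^bsub>N\<^esub>"
    using linear_graphD(6)[OF G] c by (simp add: M.M.r_neg)
  then show ?thesis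
    using c by (metis N.M.minus_equality N.M.minus_minus N.M.a_inv_closed)
qed

section \<open>Baer's criterion\<close>

text \<open>Injectivity is tested on modules whose elements have type \<^typ>\<open>'r + 'u\<close>, so ideals enter through \<^const>\<open>Inl\<close>.\<close>

definition ideal_copy :: "'u itself \<Rightarrow> ('r, 'x) ring_scheme \<Rightarrow> 'r set \<Rightarrow> ('r, 'r + 'u) module"
  where "ideal_copy (_ :: 'u itself) R J =
    \<lparr>carrier = Inl ` J, mult = undefined, one = undefined, zero = Inl \<zero>\<^bsub>R\<^esub>,
     add = (\<lambda>x y. Inl (projl x \<oplus>\<^bsub>R\<^esub> projl y)), smult = (\<lambda>a x. Inl (a \<otimes>\<^bsub>R\<^esub> projl x))\<rparr>"

lemma module_ideal_copy:
  assumes "cring R" "ideal J R"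
  shows "module R (ideal_copy U R J)"
proof -
  interpret R: cring R by fact
  interpret J: ideal J R by fact
  let ?C = "ideal_copy U R J"
  show ?thesis
  proof (rule moduleI[OF assms(1)])
    show "abelian_group ?C"
    proof (rule abelian_groupI)
      show "\<exists>y\<in>carrier ?C. y \<oplus>\<^bsub>?C\<^esub> x = \<zero>\<^bsub>?C\<^esub>" if "x \<in> carrier ?C" for x
      proof -
        from that obtain r where r: "r \<in> J" "x = Inl r" by (auto simp: ideal_copy_def)
        then show ?thesis using J.a_inv_closed[OF r(1)] J.Icarr[OF r(1)]
          by (intro bexI[of _ "Inl (\<ominus>\<^bsub>R\<^esub> r)"]) (auto simp: ideal_copy_def R.l_neg)
      qed
    qed (auto simp: ideal_copy_def R.a_assoc R.a_comm R.a_lcomm J.a_closed J.Icarr)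
  qed (auto simp: ideal_copy_def J.I_l_closed J.Icarr R.l_distr R.r_distr R.m_assoc)
qed

text \<open>
  A partial homomorphism from \<^term>\<open>R\<close> is defined on an ideal; it extends to \<^term>\<open>R\<close> by injectivity, and
  a homomorphism on \<^term>\<open>R\<close> is multiplication by the image of \<open>1\<close>.
\<close>

lemma injective_module_ideal_graph:
  fixes R :: "('r, 'x) ring_scheme" and N :: "('r, 'n, 'z) module_scheme"
  assumes inj: "injective_module (U :: 'u itself) R N"
    and G: "linear_graph R (ideal_module R (carrier R)) N G"
  shows "\<exists>x\<in>carrier N. \<forall>(r, y)\<in>G. y = r \<odot>\<^bsub>N\<^esub> x"
proof -
  have N: "module R N" using inj by (simp add: injective_module_def)
  interpret N: module R N by fact
  have cr: "cring R" by unfold_locales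
  let ?R = "ideal_module R (carrier R)"
  have M: "module R ?R" by (rule module_ideal_module[OF cr N.R.oneideal])
  have simps: "carrier ?R = carrier R" "add ?R = add R" "smult ?R = mult R" "zero ?R = zero R"
    by (simp_all add: ideal_module_def)
  note g = linear_graphD[OF G, unfolded simps]
  define J where "J = fst ` G"
  have J: "ideal J R"
  proof (rule idealI[OF N.R.ring_axioms])
    show "subgroup J (add_monoid R)"
    proof
      show "J \<subseteq> carrier (add_monoid R)" using g(1) by (auto simp: J_def)
      show "\<And>x y. x \<in> J \<Longrightarrow> y \<in> J \<Longrightarrow> x \<otimes>\<^bsub>add_monoid R\<^esub> y \<in> J"
        using g(4) by (force simp: J_def)
      show "\<one>\<^bsub>add_monoid R\<^esub> \<in> J" using g(3) by (force simp: J_def)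
      show "inv\<^bsub>add_monoid R\<^esub> x \<in> J" if x: "x \<in> J" for x
      proof -
        from x obtain y where y: "(x, y) \<in> G" by (auto simp: J_def)
        have "(\<ominus>\<^bsub>R\<^esub> \<one>\<^bsub>R\<^esub> \<otimes>\<^bsub>R\<^esub> x, \<ominus>\<^bsub>R\<^esub> \<one>\<^bsub>R\<^esub> \<odot>\<^bsub>N\<^esub> y) \<in> G" using g(5)[OF _ y] by simp
        then show ?thesis using g(1)[OF y] by (force simp: J_def N.R.l_minus simp flip: a_inv_def)
      qed
    qed
    show "\<And>a x. a \<in> J \<Longrightarrow> x \<in> carrier R \<Longrightarrow> x \<otimes>\<^bsub>R\<^esub> a \<in> J" using g(5) by (force simp: J_def)
    then show "\<And>a x. a \<in> J \<Longrightarrow> x \<in> carrier R \<Longrightarrow> a \<otimes>\<^bsub>R\<^esub> x \<in> J"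
      using g(1) by (force simp: J_def N.R.m_comm)
  qed
  define \<phi> where "\<phi> r = (THE y. (r, y) \<in> G)" for r
  have \<phi>: "\<phi> r = y" if "(r, y) \<in> G" for r y
    unfolding \<phi>_def using that linear_graph_unique[OF M N G] by blast
  have \<phi>J: "(r, \<phi> r) \<in> G" if "r \<in> J" for r using that \<phi> by (auto simp: J_def)
  let ?A = "ideal_copy U R J" and ?B = "ideal_copy U R (carrier R)"
  have idm: "id \<in> module_mono R ?A ?B"
    using ideal.Icarr[OF J] by (auto simp: module_mono_def module_hom_def ideal_copy_def)
  have fh: "(\<phi> \<circ> projl) \<in> module_hom R ?A N"
    unfolding module_hom_def ideal_copy_def
    using g(2)[OF \<phi>J] g(4)[OF \<phi>J \<phi>J] g(5)[OF _ \<phi>J] by (auto intro!: \<phi>)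
  obtain h where h: "h \<in> module_hom R ?B N" "\<forall>x\<in>carrier ?A. h (id x) = (\<phi> \<circ> projl) x"
    using inj[unfolded injective_module_def, THEN conjunct2, rule_format,
        OF module_ideal_copy[OF cr J] module_ideal_copy[OF cr N.R.oneideal] idm fh] by blast
  have hr: "h (Inl r) = r \<odot>\<^bsub>N\<^esub> h (Inl \<one>\<^bsub>R\<^esub>)" if r: "r \<in> carrier R" for r
  proof -
    have one: "Inl \<one>\<^bsub>R\<^esub> \<in> carrier ?B" by (simp add: ideal_copy_def)
    have "h (r \<odot>\<^bsub>?B\<^esub> Inl \<one>\<^bsub>R\<^esub>) = r \<odot>\<^bsub>N\<^esub> h (Inl \<one>\<^bsub>R\<^esub>)"
      using h(1) r one unfolding module_hom_def by blast
    then show ?thesis using r by (simp add: ideal_copy_def)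
  qed
  show ?thesis
  proof (intro bexI[of _ "h (Inl \<one>\<^bsub>R\<^esub>)"] ballI, clarify)
    show "h (Inl \<one>\<^bsub>R\<^esub>) \<in> carrier N" using h(1) by (auto simp: module_hom_def ideal_copy_def)
    fix r y assume ry: "(r, y) \<in> G"
    then have "r \<in> J" by (force simp: J_def)
    then have "h (Inl r) = \<phi> r" using h(2) by (auto simp: ideal_copy_def)
    then show "y = r \<odot>\<^bsub>N\<^esub> h (Inl \<one>\<^bsub>R\<^esub>)" using \<phi>[OF ry] hr[OF g(1)[OF ry]] by simp
  qed
qed

text \<open>
  Baer's argument. A maximal extension of the graph is total: given \<open>x\<close>, the partial homomorphism
  \<open>r \<mapsto> H(r x)\<close> is multiplication by some \<open>e\<close>, so \<open>x \<mapsto> e\<close> is compatible with the graph \<open>H\<close>. No relation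
  between the type of \<^term>\<open>M\<close> and the type of the test modules enters.
\<close>

lemma injective_module_extend_graph:
  assumes inj: "injective_module U R E" and M: "module R M" and G: "linear_graph R M E G"
  shows "\<exists>h\<in>module_hom R M E. \<forall>(x, y)\<in>G. h x = y"
proof -
  have E: "module R E" using inj by (simp add: injective_module_def)
  interpret M: module R M by fact
  interpret E: module R E by fact
  have "\<exists>H\<in>{H. linear_graph R M E H \<and> G \<subseteq> H}. \<forall>X\<in>{H. linear_graph R M E H \<and> G \<subseteq> H}. H \<subseteq> X \<longrightarrow> X = H"
  proof (rule subset_Zorn_nonempty)
    show "{H. linear_graph R M E H \<and> G \<subseteq> H} \<noteq> {}" using G by blast
    fix C assume C: "C \<noteq> {}" "subset.chain {H. linear_graph R M E H \<and> G \<subseteq> H} C"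
    then have lin: "linear_graph R M E H" "G \<subseteq> H" if "H \<in> C" for H
      using that unfolding pred_on.chain_def by auto
    have two: "\<exists>H\<in>C. p \<in> H \<and> q \<in> H" if "p \<in> \<Union>C" "q \<in> \<Union>C" for p q
      using that C(2) unfolding pred_on.chain_def by blast
    show "\<Union>C \<in> {H. linear_graph R M E H \<and> G \<subseteq> H}"
      unfolding mem_Collect_eq
    proof
      show "G \<subseteq> \<Union>C" using C(1) lin(2) by blast
      show "linear_graph R M E (\<Union>C)"
        unfolding linear_graph_def
      proof (intro conjI allI impI ballI)
        show "\<Union>C \<subseteq> carrier M \<times> carrier E" using lin(1) unfolding linear_graph_def by blast
        show "(\<zero>\<^bsub>M\<^esub>, \<zero>\<^bsub>E\<^esub>) \<in> \<Union>C" using C(1) lin(1) unfolding linear_graph_def by blast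
        show "(x \<oplus>\<^bsub>M\<^esub> x', y \<oplus>\<^bsub>E\<^esub> y') \<in> \<Union>C" if "(x, y) \<in> \<Union>C" "(x', y') \<in> \<Union>C" for x y x' y'
          using two[OF that] linear_graphD(4)[OF lin(1)] by blast
        show "(a \<odot>\<^bsub>M\<^esub> x, a \<odot>\<^bsub>E\<^esub> y) \<in> \<Union>C" if "a \<in> carrier R" "(x, y) \<in> \<Union>C" for a x y
          using that linear_graphD(5)[OF lin(1)] by blast
        show "y = \<zero>\<^bsub>E\<^esub>" if "(\<zero>\<^bsub>M\<^esub>, y) \<in> \<Union>C" for y
          using that linear_graphD(6)[OF lin(1)] by blast
      qed
    qed
  qed
  then obtain H where H: "linear_graph R M E H" "G \<subseteq> H"
    and max: "\<And>X. linear_graph R M E X \<Longrightarrow> G \<subseteq> X \<Longrightarrow> H \<subseteq> X \<Longrightarrow> X = H" by auto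
  note h = linear_graphD[OF H(1)]
  have total: "\<exists>y. (x, y) \<in> H" if x: "x \<in> carrier M" for x
  proof -
    let ?J = "{(r, y). r \<in> carrier R \<and> (r \<odot>\<^bsub>M\<^esub> x, y) \<in> H}"
    have "linear_graph R (ideal_module R (carrier R)) E ?J"
      unfolding linear_graph_def
    proof (intro conjI allI impI ballI)
      show "?J \<subseteq> carrier (ideal_module R (carrier R)) \<times> carrier E"
        using h(2) by (auto simp: ideal_module_def)
      show "(\<zero>\<^bsub>ideal_module R (carrier R)\<^esub>, \<zero>\<^bsub>E\<^esub>) \<in> ?J"
        using h(3) x by (simp add: ideal_module_def)
      show "(r \<oplus>\<^bsub>ideal_module R (carrier R)\<^esub> r', y \<oplus>\<^bsub>E\<^esub> y') \<in> ?J"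
        if "(r, y) \<in> ?J" "(r', y') \<in> ?J" for r y r' y'
        using that h(4)[of "r \<odot>\<^bsub>M\<^esub> x" y] x by (auto simp: ideal_module_def M.smult_l_distr)
      show "(a \<odot>\<^bsub>ideal_module R (carrier R)\<^esub> r, a \<odot>\<^bsub>E\<^esub> y) \<in> ?J"
        if "a \<in> carrier R" "(r, y) \<in> ?J" for a r y
        using that h(5)[of a "r \<odot>\<^bsub>M\<^esub> x" y] x by (auto simp: ideal_module_def M.smult_assoc1)
      show "y = \<zero>\<^bsub>E\<^esub>" if "(\<zero>\<^bsub>ideal_module R (carrier R)\<^esub>, y) \<in> ?J" for y
        using that h(6) x by (simp add: ideal_module_def)
    qed
    from injective_module_ideal_graph[OF inj this]
    obtain e where e: "e \<in> carrier E"
      and ex: "\<And>r y. r \<in> carrier R \<Longrightarrow> (r \<odot>\<^bsub>M\<^esub> x, y) \<in> H \<Longrightarrow> y = r \<odot>\<^bsub>E\<^esub> e" by blast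
    define X where "X = {(y \<oplus>\<^bsub>M\<^esub> r \<odot>\<^bsub>M\<^esub> x, d \<oplus>\<^bsub>E\<^esub> r \<odot>\<^bsub>E\<^esub> e) |y d r. (y, d) \<in> H \<and> r \<in> carrier R}"
    have XI: "(y \<oplus>\<^bsub>M\<^esub> r \<odot>\<^bsub>M\<^esub> x, d \<oplus>\<^bsub>E\<^esub> r \<odot>\<^bsub>E\<^esub> e) \<in> X" if "(y, d) \<in> H" "r \<in> carrier R" for y d r
      using that unfolding X_def by blast
    have HX: "H \<subseteq> X"
    proof clarify
      fix y d assume yd: "(y, d) \<in> H"
      then show "(y, d) \<in> X" using XI[OF yd M.R.zero_closed] h(1,2)[OF yd] x e by simp
    qed
    have "linear_graph R M E X"
      unfolding linear_graph_def
    proof (intro conjI allI impI ballI)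
      show "X \<subseteq> carrier M \<times> carrier E" unfolding X_def using h(1,2) x e by auto
      show "(\<zero>\<^bsub>M\<^esub>, \<zero>\<^bsub>E\<^esub>) \<in> X" using HX h(3) by blast
      show "(p \<oplus>\<^bsub>M\<^esub> p', q \<oplus>\<^bsub>E\<^esub> q') \<in> X" if pq: "(p, q) \<in> X" "(p', q') \<in> X" for p q p' q'
      proof -
        from pq obtain y d r y' d' r' where *: "p = y \<oplus>\<^bsub>M\<^esub> r \<odot>\<^bsub>M\<^esub> x" "q = d \<oplus>\<^bsub>E\<^esub> r \<odot>\<^bsub>E\<^esub> e" "(y, d) \<in> H" "r \<in> carrier R"
          "p' = y' \<oplus>\<^bsub>M\<^esub> r' \<odot>\<^bsub>M\<^esub> x" "q' = d' \<oplus>\<^bsub>E\<^esub> r' \<odot>\<^bsub>E\<^esub> e" "(y', d') \<in> H" "r' \<in> carrier R"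
          unfolding X_def by blast
        have "p \<oplus>\<^bsub>M\<^esub> p' = (y \<oplus>\<^bsub>M\<^esub> y') \<oplus>\<^bsub>M\<^esub> (r \<oplus>\<^bsub>R\<^esub> r') \<odot>\<^bsub>M\<^esub> x" "q \<oplus>\<^bsub>E\<^esub> q' = (d \<oplus>\<^bsub>E\<^esub> d') \<oplus>\<^bsub>E\<^esub> (r \<oplus>\<^bsub>R\<^esub> r') \<odot>\<^bsub>E\<^esub> e"
          using * x e h(1)[OF *(3)] h(2)[OF *(3)] h(1)[OF *(7)] h(2)[OF *(7)]
          by (simp_all add: M.smult_l_distr E.smult_l_distr M.M.a_ac E.M.a_ac)
        then show ?thesis using XI[OF h(4)[OF *(3,7)], of "r \<oplus>\<^bsub>R\<^esub> r'"] * by simp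
      qed
      show "(a \<odot>\<^bsub>M\<^esub> p, a \<odot>\<^bsub>E\<^esub> q) \<in> X" if a: "a \<in> carrier R" and pq: "(p, q) \<in> X" for a p q
      proof -
        from pq obtain y d r where *: "p = y \<oplus>\<^bsub>M\<^esub> r \<odot>\<^bsub>M\<^esub> x" "q = d \<oplus>\<^bsub>E\<^esub> r \<odot>\<^bsub>E\<^esub> e" "(y, d) \<in> H" "r \<in> carrier R"
          unfolding X_def by blast
        have "a \<odot>\<^bsub>M\<^esub> p = a \<odot>\<^bsub>M\<^esub> y \<oplus>\<^bsub>M\<^esub> (a \<otimes>\<^bsub>R\<^esub> r) \<odot>\<^bsub>M\<^esub> x" "a \<odot>\<^bsub>E\<^esub> q = a \<odot>\<^bsub>E\<^esub> d \<oplus>\<^bsub>E\<^esub> (a \<otimes>\<^bsub>R\<^esub> r) \<odot>\<^bsub>E\<^esub> e"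
          using * x e a h(1,2)[OF *(3)]
          by (simp_all add: M.smult_r_distr E.smult_r_distr M.smult_assoc1 E.smult_assoc1)
        then show ?thesis using XI[OF h(5)[OF a *(3)], of "a \<otimes>\<^bsub>R\<^esub> r"] * a by simp
      qed
      show "q = \<zero>\<^bsub>E\<^esub>" if q: "(\<zero>\<^bsub>M\<^esub>, q) \<in> X" for q
      proof -
        from q obtain y d r where *: "\<zero>\<^bsub>M\<^esub> = y \<oplus>\<^bsub>M\<^esub> r \<odot>\<^bsub>M\<^esub> x" "q = d \<oplus>\<^bsub>E\<^esub> r \<odot>\<^bsub>E\<^esub> e" "(y, d) \<in> H" "r \<in> carrier R"
          unfolding X_def by blast
        note c = h(1,2)[OF *(3)]
        have "r \<odot>\<^bsub>M\<^esub> x = \<ominus>\<^bsub>M\<^esub> y"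
          using *(1,4) c x by (metis M.M.a_comm M.M.minus_equality M.smult_closed)
        then have "\<ominus>\<^bsub>E\<^esub> d = r \<odot>\<^bsub>E\<^esub> e"
          using ex[OF *(4)] linear_graph_minus[OF M E H(1) *(3)] by simp
        then show ?thesis using *(2) c by (metis E.M.r_neg)
      qed
    qed
    then have "X = H" using max H(2) HX by blast
    moreover have "(\<zero>\<^bsub>M\<^esub> \<oplus>\<^bsub>M\<^esub> \<one>\<^bsub>R\<^esub> \<odot>\<^bsub>M\<^esub> x, \<zero>\<^bsub>E\<^esub> \<oplus>\<^bsub>E\<^esub> \<one>\<^bsub>R\<^esub> \<odot>\<^bsub>E\<^esub> e) \<in> X" by (rule XI) (simp_all add: h(3))
    ultimately show ?thesis using x e by auto
  qed
  define \<phi> where "\<phi> x = (THE y. (x, y) \<in> H)" for x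
  have \<phi>: "\<phi> x = y" if "(x, y) \<in> H" for x y
    unfolding \<phi>_def using that linear_graph_unique[OF M E H(1)] by blast
  have \<phi>H: "(x, \<phi> x) \<in> H" if "x \<in> carrier M" for x using total[OF that] \<phi> by auto
  have "\<phi> \<in> module_hom R M E"
    unfolding module_hom_def
    using h(2)[OF \<phi>H] h(4)[OF \<phi>H \<phi>H] h(5)[OF _ \<phi>H] by (auto intro!: \<phi>)
  then show ?thesis using \<phi> H(2) by blast
qed

text \<open>
  The hypothesis says that \<open>b \<mapsto> x, a \<mapsto> 0\<close> is well defined on the ideal generated by \<^term>\<open>a\<close> and
  \<^term>\<open>b\<close>; the solution \<open>y\<close> is the image of \<open>1\<close> under an extension to \<^term>\<open>R\<close>.
\<close>

lemma injective_module_solve: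
  assumes inj: "injective_module U R N" and x: "x \<in> carrier N" and ab: "a \<in> carrier R" "b \<in> carrier R"
    and compat: "\<And>r s. r \<in> carrier R \<Longrightarrow> s \<in> carrier R \<Longrightarrow> r \<otimes>\<^bsub>R\<^esub> b = s \<otimes>\<^bsub>R\<^esub> a \<Longrightarrow> r \<odot>\<^bsub>N\<^esub> x = \<zero>\<^bsub>N\<^esub>"
  shows "\<exists>y\<in>carrier N. a \<odot>\<^bsub>N\<^esub> y = \<zero>\<^bsub>N\<^esub> \<and> b \<odot>\<^bsub>N\<^esub> y = x"
proof -
  have N: "module R N" using inj by (simp add: injective_module_def)
  interpret N: module R N by fact
  let ?M = "ideal_module R (carrier R)"
  define G where "G = {(r \<otimes>\<^bsub>R\<^esub> b \<oplus>\<^bsub>R\<^esub> s \<otimes>\<^bsub>R\<^esub> a, r \<odot>\<^bsub>N\<^esub> x) |r s. r \<in> carrier R \<and> s \<in> carrier R}"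
  have GI: "(p, q) \<in> G" if "r \<in> carrier R" "s \<in> carrier R" "p = r \<otimes>\<^bsub>R\<^esub> b \<oplus>\<^bsub>R\<^esub> s \<otimes>\<^bsub>R\<^esub> a" "q = r \<odot>\<^bsub>N\<^esub> x" for p q r s
    using that unfolding G_def by blast
  have GE: "\<exists>r s. r \<in> carrier R \<and> s \<in> carrier R \<and> p = r \<otimes>\<^bsub>R\<^esub> b \<oplus>\<^bsub>R\<^esub> s \<otimes>\<^bsub>R\<^esub> a \<and> q = r \<odot>\<^bsub>N\<^esub> x" if "(p, q) \<in> G" for p q
    using that unfolding G_def by blast
  have "linear_graph R ?M N G"
    unfolding linear_graph_def
  proof (intro conjI allI impI ballI)
    show "G \<subseteq> carrier ?M \<times> carrier N" unfolding G_def using ab x by (auto simp: ideal_module_def)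
    show "(\<zero>\<^bsub>?M\<^esub>, \<zero>\<^bsub>N\<^esub>) \<in> G" by (rule GI[of "\<zero>\<^bsub>R\<^esub>" "\<zero>\<^bsub>R\<^esub>"]) (simp_all add: ideal_module_def ab x)
    fix p q assume "(p, q) \<in> G"
    then obtain r s where rs: "r \<in> carrier R" "s \<in> carrier R" "p = r \<otimes>\<^bsub>R\<^esub> b \<oplus>\<^bsub>R\<^esub> s \<otimes>\<^bsub>R\<^esub> a" "q = r \<odot>\<^bsub>N\<^esub> x"
      using GE by blast
    show "(p \<oplus>\<^bsub>?M\<^esub> p', q \<oplus>\<^bsub>N\<^esub> q') \<in> G" if "(p', q') \<in> G" for p' q'
    proof -
      from GE[OF that] obtain r' s' where rs': "r' \<in> carrier R" "s' \<in> carrier R"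
        "p' = r' \<otimes>\<^bsub>R\<^esub> b \<oplus>\<^bsub>R\<^esub> s' \<otimes>\<^bsub>R\<^esub> a" "q' = r' \<odot>\<^bsub>N\<^esub> x" by blast
      show ?thesis
        by (rule GI[of "r \<oplus>\<^bsub>R\<^esub> r'" "s \<oplus>\<^bsub>R\<^esub> s'"])
          (use rs rs' ab x in \<open>simp_all add: ideal_module_def N.R.l_distr N.R.a_ac N.M.a_ac N.smult_l_distr\<close>)
    qed
    show "(c \<odot>\<^bsub>?M\<^esub> p, c \<odot>\<^bsub>N\<^esub> q) \<in> G" if "c \<in> carrier R" for c
      by (rule GI[of "c \<otimes>\<^bsub>R\<^esub> r" "c \<otimes>\<^bsub>R\<^esub> s"])
        (use rs that ab x in \<open>simp_all add: ideal_module_def N.R.r_distr N.R.m_assoc N.smult_assoc1\<close>)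
  next
    fix q assume "(\<zero>\<^bsub>?M\<^esub>, q) \<in> G"
    then have "(\<zero>\<^bsub>R\<^esub>, q) \<in> G" by (simp add: ideal_module_def)
    then obtain r s where rs: "r \<in> carrier R" "s \<in> carrier R" "\<zero>\<^bsub>R\<^esub> = r \<otimes>\<^bsub>R\<^esub> b \<oplus>\<^bsub>R\<^esub> s \<otimes>\<^bsub>R\<^esub> a" "q = r \<odot>\<^bsub>N\<^esub> x"
      using GE by blast
    have "r \<otimes>\<^bsub>R\<^esub> b = \<ominus>\<^bsub>R\<^esub> (s \<otimes>\<^bsub>R\<^esub> a)"
      using rs ab by (simp add: N.R.minus_equality)
    then have "r \<otimes>\<^bsub>R\<^esub> b = (\<ominus>\<^bsub>R\<^esub> s) \<otimes>\<^bsub>R\<^esub> a" using rs ab by (simp add: N.R.l_minus)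
    then show "q = \<zero>\<^bsub>N\<^esub>" unfolding rs(4) using rs by (intro compat[of r "\<ominus>\<^bsub>R\<^esub> s"]) simp_all
  qed
  from injective_module_ideal_graph[OF inj this]
  obtain y where y: "y \<in> carrier N" "\<And>p q. (p, q) \<in> G \<Longrightarrow> q = p \<odot>\<^bsub>N\<^esub> y" by blast
  have "(a, \<zero>\<^bsub>N\<^esub>) \<in> G" by (rule GI[of "\<zero>\<^bsub>R\<^esub>" "\<one>\<^bsub>R\<^esub>"]) (simp_all add: ab x)
  moreover have "(b, x) \<in> G" by (rule GI[of "\<one>\<^bsub>R\<^esub>" "\<zero>\<^bsub>R\<^esub>"]) (simp_all add: ab x)
  ultimately show ?thesis using y by (intro bexI[of _ y]) auto
qed

section \<open>Prime ideals of noetherian rings\<close>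

lemma (in noetherian_ring) maximal_in_ideal_family:
  assumes "F \<noteq> {}" "\<And>J. J \<in> F \<Longrightarrow> ideal J R"
  obtains M where "M \<in> F" "\<And>J. J \<in> F \<Longrightarrow> M \<subseteq> J \<Longrightarrow> J = M"
proof -
  have "\<exists>M\<in>F. \<forall>J\<in>F. M \<subseteq> J \<longrightarrow> J = M"
  proof (rule subset_Zorn_nonempty[OF assms(1)])
    fix C assume C: "C \<noteq> {}" "subset.chain F C"
    have CF: "C \<subseteq> F" using C(2) by (simp add: subset.chain_def)
    have "subset.chain {J. ideal J R} C"
      using C(2) assms(2) by (auto simp: subset.chain_def)
    then have "\<Union>C \<in> C" by (rule ideal_chain_is_trivial[OF C(1)])
    then show "\<Union>C \<in> F" using CF by (rule subsetD[rotated])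
  qed
  then obtain M where M: "M \<in> F" and max: "\<forall>J\<in>F. M \<subseteq> J \<longrightarrow> J = M" by (rule bexE)
  show thesis by (rule that[OF M]) (rule max[rule_format])
qed

lemma prime_subset_maximal:
  assumes "noetherian_ring R" "local_ring R \<mm>" "primeideal P R"
  shows "P \<subseteq> \<mm>"
proof -
  interpret noetherian_ring R by fact
  interpret P: primeideal P R by fact
  let ?F = "{J. ideal J R \<and> J \<noteq> carrier R \<and> P \<subseteq> J}"
  have "?F \<noteq> {}" using P.I_notcarr P.is_ideal by auto
  from this obtain M where M: "M \<in> ?F" and max: "\<And>J. J \<in> ?F \<Longrightarrow> M \<subseteq> J \<Longrightarrow> J = M"
    by (rule maximal_in_ideal_family) simp_all
  have "maximalideal M R"
  proof (rule maximalidealI)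
    show "ideal M R" using M by simp
    show "carrier R \<noteq> M" using M by auto
    show "J = M \<or> J = carrier R" if "ideal J R" "M \<subseteq> J" for J
      using max[of J] M that by blast
  qed
  then have "M \<in> {J. maximalideal J R}" by simp
  then have "M = \<mm>" using assms(2) unfolding local_ring_def by simp
  then show ?thesis using M by simp
qed

lemma (in module) annihilator_ideal:
  assumes "x \<in> carrier M"
  shows "ideal (annihilator R M x) R"
proof (rule idealI[OF R.ring_axioms])
  show "subgroup (annihilator R M x) (add_monoid R)"
  proof (rule R.add.subgroupI)
    show "annihilator R M x \<subseteq> carrier R" by (auto simp: annihilator_def)
    show "annihilator R M x \<noteq> {}"
      using assms R.zero_closed smult_l_null unfolding annihilator_def by blast
    show "\<ominus> a \<in> annihilator R M x" if "a \<in> annihilator R M x" for a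
      using that assms by (simp add: annihilator_def smult_l_minus)
    show "a \<oplus> b \<in> annihilator R M x" if "a \<in> annihilator R M x" "b \<in> annihilator R M x" for a b
      using that assms by (simp add: annihilator_def smult_l_distr)
  qed
  show *: "r \<otimes> a \<in> annihilator R M x" if "a \<in> annihilator R M x" "r \<in> carrier R" for a r
    using that assms by (simp add: annihilator_def smult_assoc1)
  show "a \<otimes> r \<in> annihilator R M x" if "a \<in> annihilator R M x" "r \<in> carrier R" for a r
    using *[OF that] that by (simp add: annihilator_def R.m_comm)
qed

text \<open>
  Among the annihilators of the nonzero multiples of \<^term>\<open>x\<close> there is a maximal one, \<open>ann(y)\<close>. It is prime:
  if \<open>a b y = 0\<close> and \<open>b y \<noteq> 0\<close>, then \<open>ann(b y)\<close> contains \<open>ann(y)\<close>, hence equals it, and contains \<open>a\<close>.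
\<close>

lemma (in module) exists_associated_multiple:
  assumes "noetherian_ring R" "x \<in> carrier M" "x \<noteq> \<zero>\<^bsub>M\<^esub>"
  shows "\<exists>r\<in>carrier R. annihilator R M (r \<odot>\<^bsub>M\<^esub> x) \<in> Ass R M"
proof -
  interpret N: noetherian_ring R by fact
  define F where "F = {annihilator R M (r \<odot>\<^bsub>M\<^esub> x) |r. r \<in> carrier R \<and> r \<odot>\<^bsub>M\<^esub> x \<noteq> \<zero>\<^bsub>M\<^esub>}"
  have "annihilator R M (\<one> \<odot>\<^bsub>M\<^esub> x) \<in> F"
    using assms(2,3) unfolding F_def by (intro CollectI exI[of _ \<one>]) (simp)
  then have nonempty: "F \<noteq> {}" by blast
  have ideals: "\<And>J. J \<in> F \<Longrightarrow> ideal J R" using assms(2) unfolding F_def by (auto intro: annihilator_ideal)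
  obtain P where P: "P \<in> F" and max: "\<And>J. J \<in> F \<Longrightarrow> P \<subseteq> J \<Longrightarrow> J = P"
    using N.maximal_in_ideal_family[of F] nonempty ideals by blast
  obtain r where r: "r \<in> carrier R" "r \<odot>\<^bsub>M\<^esub> x \<noteq> \<zero>\<^bsub>M\<^esub>" "P = annihilator R M (r \<odot>\<^bsub>M\<^esub> x)"
    using P unfolding F_def by blast
  let ?y = "r \<odot>\<^bsub>M\<^esub> x"
  have y: "?y \<in> carrier M" using r assms by simp
  have "primeideal (annihilator R M ?y) R"
  proof (rule primeidealI[OF annihilator_ideal[OF y] R.is_cring])
    have "\<one> \<notin> annihilator R M ?y" using r y by (simp add: annihilator_def)
    then show "carrier R \<noteq> annihilator R M ?y" by auto
    fix a b assume ab: "a \<in> carrier R" "b \<in> carrier R" "a \<otimes> b \<in> annihilator R M ?y"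
    show "a \<in> annihilator R M ?y \<or> b \<in> annihilator R M ?y"
    proof (rule ccontr)
      assume *: "\<not> ?thesis"
      then have b: "(b \<otimes> r) \<odot>\<^bsub>M\<^esub> x \<noteq> \<zero>\<^bsub>M\<^esub>" using ab r assms(2) by (simp add: annihilator_def smult_assoc1)
      have "annihilator R M ?y \<subseteq> annihilator R M ((b \<otimes> r) \<odot>\<^bsub>M\<^esub> x)"
      proof
        fix c assume c: "c \<in> annihilator R M ?y"
        then have cR: "c \<in> carrier R" "c \<odot>\<^bsub>M\<^esub> ?y = \<zero>\<^bsub>M\<^esub>" by (auto simp: annihilator_def)
        have "c \<odot>\<^bsub>M\<^esub> (b \<odot>\<^bsub>M\<^esub> ?y) = b \<odot>\<^bsub>M\<^esub> (c \<odot>\<^bsub>M\<^esub> ?y)"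
          using cR ab y by (metis R.m_comm smult_assoc1)
        then show "c \<in> annihilator R M ((b \<otimes> r) \<odot>\<^bsub>M\<^esub> x)"
          using cR ab r assms(2) by (simp add: annihilator_def smult_assoc1)
      qed
      moreover have "annihilator R M ((b \<otimes> r) \<odot>\<^bsub>M\<^esub> x) \<in> F"
        using b ab(2) r(1) unfolding F_def by (intro CollectI exI[of _ "b \<otimes> r"]) simp
      ultimately have "annihilator R M ((b \<otimes> r) \<odot>\<^bsub>M\<^esub> x) = annihilator R M ?y"
        using max r(3) by simp
      moreover have "a \<in> annihilator R M ((b \<otimes> r) \<odot>\<^bsub>M\<^esub> x)"
        using ab r assms(2) by (simp add: annihilator_def smult_assoc1)
      ultimately show False using * by simp
    qed
  qed
  then show ?thesis using r y unfolding Ass_def by blast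
qed

section \<open>Localized ideals\<close>

context primeideal
begin

lemma frac_zero_iff:
  assumes "a \<in> carrier R" "s \<in> carrier R - I"
  shows "loc_frac R I a s = loc_frac R I \<zero> \<one> \<longleftrightarrow> (\<exists>u\<in>carrier R - I. u \<otimes> a = \<zero>)"
  using assms denom_one by (subst frac_eq_iff) auto

lemma frac_closed:
  "\<lbrakk>a \<in> carrier R; s \<in> carrier R - I\<rbrakk> \<Longrightarrow> loc_frac R I a s \<in> carrier (localization R I)"
  unfolding carrier_localization by blast

lemma cring_localization: "cring (localization R I)"
proof -
  let ?L = "localization R I"
  have frac: "\<exists>a s. x = loc_frac R I a s \<and> a \<in> carrier R \<and> s \<in> carrier R - I" if "x \<in> carrier ?L" for x
    using that unfolding carrier_localization by blast
  have zero: "\<zero>\<^bsub>?L\<^esub> = loc_frac R I \<zero> \<one>" and one: "\<one>\<^bsub>?L\<^esub> = loc_frac R I \<one> \<one>"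
    by (simp_all add: localization_def)
  show ?thesis
  proof (rule cringI)
    show "abelian_group ?L"
    proof (rule abelian_groupI)
      fix x y assume "x \<in> carrier ?L" "y \<in> carrier ?L"
      then obtain a s b t where
        x: "x = loc_frac R I a s" "a \<in> carrier R" "s \<in> carrier R - I" and
        y: "y = loc_frac R I b t" "b \<in> carrier R" "t \<in> carrier R - I"
        using frac by metis
      note d = denom_mult[OF x(3) y(3)]
      show "x \<oplus>\<^bsub>?L\<^esub> y \<in> carrier ?L"
        unfolding x(1) y(1) using x(2,3) y(2,3) d by (subst add_frac) (auto intro!: frac_closed)
      show "x \<oplus>\<^bsub>?L\<^esub> y = y \<oplus>\<^bsub>?L\<^esub> x"
        unfolding x(1) y(1) using x(2,3) y(2,3) by (simp add: add_frac m_comm a_comm)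
      fix z assume "z \<in> carrier ?L"
      then obtain c w where z: "z = loc_frac R I c w" "c \<in> carrier R" "w \<in> carrier R - I"
        using frac by metis
      show "x \<oplus>\<^bsub>?L\<^esub> y \<oplus>\<^bsub>?L\<^esub> z = x \<oplus>\<^bsub>?L\<^esub> (y \<oplus>\<^bsub>?L\<^esub> z)"
        unfolding x(1) y(1) z(1) using x(2,3) y(2,3) z(2,3) d denom_mult[OF y(3) z(3)]
        by (simp add: add_frac l_distr r_distr m_ac a_ac)
    next
      fix x assume "x \<in> carrier ?L"
      then obtain a s where x: "x = loc_frac R I a s" "a \<in> carrier R" "s \<in> carrier R - I"
        using frac by metis
      show "\<zero>\<^bsub>?L\<^esub> \<oplus>\<^bsub>?L\<^esub> x = x"
        unfolding x(1) zero using x(2,3) denom_one by (simp add: add_frac)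
      have "loc_frac R I (\<ominus> a) s \<oplus>\<^bsub>?L\<^esub> x = \<zero>\<^bsub>?L\<^esub>"
        unfolding x(1) zero using x(2,3) denom_one denom_mult[OF x(3,3)]
        by (auto simp: add_frac frac_zero_iff l_minus l_neg intro!: bexI[of _ \<one>])
      then show "\<exists>y\<in>carrier ?L. y \<oplus>\<^bsub>?L\<^esub> x = \<zero>\<^bsub>?L\<^esub>" using frac_closed[of "\<ominus> a" s] x(2,3) by auto
    qed (simp add: zero frac_closed denom_one[simplified])
    show "comm_monoid ?L"
    proof (rule comm_monoidI)
      fix x y assume "x \<in> carrier ?L" "y \<in> carrier ?L"
      then obtain a s b t where
        x: "x = loc_frac R I a s" "a \<in> carrier R" "s \<in> carrier R - I" and
        y: "y = loc_frac R I b t" "b \<in> carrier R" "t \<in> carrier R - I"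
        using frac by metis
      note d = denom_mult[OF x(3) y(3)]
      show "x \<otimes>\<^bsub>?L\<^esub> y \<in> carrier ?L"
        unfolding x(1) y(1) using x(2,3) y(2,3) d by (subst mult_frac) (auto intro!: frac_closed)
      show "x \<otimes>\<^bsub>?L\<^esub> y = y \<otimes>\<^bsub>?L\<^esub> x"
        unfolding x(1) y(1) using x(2,3) y(2,3) by (simp add: mult_frac m_comm)
      fix z assume "z \<in> carrier ?L"
      then obtain c w where z: "z = loc_frac R I c w" "c \<in> carrier R" "w \<in> carrier R - I"
        using frac by metis
      show "x \<otimes>\<^bsub>?L\<^esub> y \<otimes>\<^bsub>?L\<^esub> z = x \<otimes>\<^bsub>?L\<^esub> (y \<otimes>\<^bsub>?L\<^esub> z)"
        unfolding x(1) y(1) z(1) using x(2,3) y(2,3) z(2,3) d denom_mult[OF y(3) z(3)]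
        by (simp add: mult_frac m_assoc)
    next
      fix x assume "x \<in> carrier ?L"
      then obtain a s where x: "x = loc_frac R I a s" "a \<in> carrier R" "s \<in> carrier R - I"
        using frac by metis
      show "\<one>\<^bsub>?L\<^esub> \<otimes>\<^bsub>?L\<^esub> x = x"
        unfolding x(1) one using x(2,3) denom_one by (simp add: mult_frac)
    qed (simp add: one frac_closed denom_one[simplified])
    fix x y z assume "x \<in> carrier ?L" "y \<in> carrier ?L" "z \<in> carrier ?L"
    then obtain a s b t c w where
      x: "x = loc_frac R I a s" "a \<in> carrier R" "s \<in> carrier R - I" and
      y: "y = loc_frac R I b t" "b \<in> carrier R" "t \<in> carrier R - I" and
      z: "z = loc_frac R I c w" "c \<in> carrier R" "w \<in> carrier R - I"
      using frac by metis
    note d = denom_mult[OF x(3) y(3)] denom_mult[OF x(3) z(3)] denom_mult[OF y(3) z(3)]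
    have "loc_frac R I ((a \<otimes> t \<oplus> b \<otimes> s) \<otimes> c) (s \<otimes> t \<otimes> w) =
        loc_frac R I (a \<otimes> c \<otimes> (t \<otimes> w) \<oplus> b \<otimes> c \<otimes> (s \<otimes> w)) (s \<otimes> w \<otimes> (t \<otimes> w))"
      using x(2,3) y(2,3) z(2,3) d denom_mult[OF d(1) z(3)] denom_mult[OF d(2,3)] denom_one
      by (subst frac_eq_iff) (auto simp: l_distr r_distr m_ac intro!: bexI[of _ \<one>])
    then show "(x \<oplus>\<^bsub>?L\<^esub> y) \<otimes>\<^bsub>?L\<^esub> z = x \<otimes>\<^bsub>?L\<^esub> z \<oplus>\<^bsub>?L\<^esub> y \<otimes>\<^bsub>?L\<^esub> z"
      unfolding x(1) y(1) z(1) using x(2,3) y(2,3) z(2,3) d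
      by (simp add: mult_frac add_frac)
  qed
qed

lemma localized_ideal_eq:
  assumes "ideal J R"
  shows "localized_ideal R I J = {loc_frac R I b s |b s. b \<in> J \<and> s \<in> carrier R - I}" (is "_ = ?F")
proof
  interpret L: cring "localization R I" by (rule cring_localization)
  interpret J: ideal J R by fact
  let ?L = "localization R I"
  let ?J = "(\<lambda>a. loc_frac R I a \<one>) ` J"
  have zero: "\<zero>\<^bsub>?L\<^esub> = loc_frac R I \<zero> \<one>" by (simp add: localization_def)
  have JL: "?J \<subseteq> carrier ?L" using J.Icarr denom_one by (auto intro: frac_closed)
  have l_closed: "x \<otimes>\<^bsub>?L\<^esub> y \<in> ?F" if xy: "x \<in> carrier ?L" "y \<in> ?F" for x y
  proof -
    from xy obtain a s b t where
      x: "x = loc_frac R I a s" "a \<in> carrier R" "s \<in> carrier R - I" and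
      y: "y = loc_frac R I b t" "b \<in> J" "t \<in> carrier R - I"
      unfolding carrier_localization by blast
    have "x \<otimes>\<^bsub>?L\<^esub> y = loc_frac R I (a \<otimes> b) (s \<otimes> t)"
      unfolding x(1) y(1) using x y J.Icarr by (simp add: mult_frac)
    then show ?thesis using J.I_l_closed[OF y(2) x(2)] denom_mult[OF x(3) y(3)] by blast
  qed
  have FL: "?F \<subseteq> carrier ?L" using J.Icarr by (auto intro: frac_closed)
  have "ideal ?F ?L"
  proof (rule idealI[OF L.ring_axioms])
    show "subgroup ?F (add_monoid ?L)"
    proof (rule L.add.subgroupI)
      show "?F \<subseteq> carrier ?L" by (rule FL)
      show "?F \<noteq> {}" using J.zero_closed denom_one by blast
      show "\<ominus>\<^bsub>?L\<^esub> x \<in> ?F" if x: "x \<in> ?F" for x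
      proof -
        have "(\<ominus>\<^bsub>?L\<^esub> \<one>\<^bsub>?L\<^esub>) \<otimes>\<^bsub>?L\<^esub> x \<in> ?F" by (rule l_closed[OF _ x]) simp
        then show ?thesis using subsetD[OF FL x] by (simp add: L.l_minus)
      qed
      show "x \<oplus>\<^bsub>?L\<^esub> y \<in> ?F" if xy: "x \<in> ?F" "y \<in> ?F" for x y
      proof -
        from xy obtain a s b t where
          x: "x = loc_frac R I a s" "a \<in> J" "s \<in> carrier R - I" and
          y: "y = loc_frac R I b t" "b \<in> J" "t \<in> carrier R - I" by blast
        have "x \<oplus>\<^bsub>?L\<^esub> y = loc_frac R I (a \<otimes> t \<oplus> b \<otimes> s) (s \<otimes> t)"
          unfolding x(1) y(1) using x y J.Icarr by (simp add: add_frac)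
        moreover have "a \<otimes> t \<oplus> b \<otimes> s \<in> J" using x y by (simp add: J.a_closed J.I_r_closed)
        ultimately show ?thesis using denom_mult[OF x(3) y(3)] by blast
      qed
    qed
    show "x \<otimes>\<^bsub>?L\<^esub> a \<in> ?F" if "a \<in> ?F" "x \<in> carrier ?L" for a x by (rule l_closed[OF that(2,1)])
    show "a \<otimes>\<^bsub>?L\<^esub> x \<in> ?F" if "a \<in> ?F" "x \<in> carrier ?L" for a x
      using l_closed[OF that(2,1)] L.m_comm[OF that(2) subsetD[OF FL that(1)]] by simp
  qed
  moreover have "?J \<subseteq> ?F" using denom_one by blast
  ultimately show "localized_ideal R I J \<subseteq> ?F"
    unfolding localized_ideal_def by (rule L.genideal_minimal)
  show "?F \<subseteq> localized_ideal R I J"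
  proof
    interpret G: ideal "localized_ideal R I J" ?L
      unfolding localized_ideal_def by (rule L.genideal_ideal[OF JL])
    fix x assume "x \<in> ?F"
    then obtain b s where x: "x = loc_frac R I b s" "b \<in> J" "s \<in> carrier R - I" by blast
    have "loc_frac R I b \<one> \<in> localized_ideal R I J"
      unfolding localized_ideal_def using L.genideal_self[OF JL] x(2) by blast
    moreover have "loc_frac R I \<one> s \<in> carrier ?L" using x(3) by (auto intro: frac_closed)
    ultimately have "loc_frac R I \<one> s \<otimes>\<^bsub>?L\<^esub> loc_frac R I b \<one> \<in> localized_ideal R I J"
      by (rule G.I_l_closed)
    then show "x \<in> localized_ideal R I J"
      using x J.Icarr denom_one by (simp add: mult_frac)
  qed
qed

lemma ideal_localized_ideal:
  assumes "ideal J R"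
  shows "ideal (localized_ideal R I J) (localization R I)"
proof -
  interpret L: cring "localization R I" by (rule cring_localization)
  interpret J: ideal J R by fact
  show ?thesis
    unfolding localized_ideal_def
    by (rule L.genideal_ideal) (use J.Icarr denom_one in \<open>auto intro: frac_closed\<close>)
qed

end

text \<open>An isomorphism with the ring itself amounts to the preimage \<^term>\<open>g\<close> of \<open>1\<close>, a regular generator.\<close>

lemma ideal_module_iso_ring_iff:
  assumes "cring R" "ideal J R"
  shows "modules_isomorphic R (ideal_module R J) (ideal_module R (carrier R)) \<longleftrightarrow>
    (\<exists>g\<in>J. (\<forall>x\<in>J. \<exists>r\<in>carrier R. x = r \<otimes>\<^bsub>R\<^esub> g) \<and> (\<forall>r\<in>carrier R. r \<otimes>\<^bsub>R\<^esub> g = \<zero>\<^bsub>R\<^esub> \<longrightarrow> r = \<zero>\<^bsub>R\<^esub>))"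
    (is "?iso \<longleftrightarrow> ?gen")
proof
  interpret cring R by fact
  interpret J: ideal J R by fact
  assume ?iso
  then obtain f where f: "f \<in> module_hom R (ideal_module R J) (ideal_module R (carrier R))" "bij_betw f J (carrier R)"
    by (auto simp: modules_isomorphic_def module_iso_def ideal_module_def)
  have fJ: "f x \<in> carrier R" if "x \<in> J" for x using f(1) that by (auto simp: module_hom_def ideal_module_def)
  have fm: "f (r \<otimes>\<^bsub>R\<^esub> x) = r \<otimes>\<^bsub>R\<^esub> f x" if "r \<in> carrier R" "x \<in> J" for r x
    using f(1) that by (auto simp: module_hom_def ideal_module_def)
  have inj: "inj_on f J" and surj: "f ` J = carrier R" using f(2) by (auto simp: bij_betw_def)
  have "\<one>\<^bsub>R\<^esub> \<in> f ` J" using surj by simp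
  then obtain g where g: "g \<in> J" "f g = \<one>\<^bsub>R\<^esub>" by auto
  show ?gen
  proof (rule bexI[of _ g], intro conjI ballI impI)
    fix x assume x: "x \<in> J"
    have "f (f x \<otimes>\<^bsub>R\<^esub> g) = f x" using fm[OF fJ[OF x] g(1)] g(2) fJ[OF x] by simp
    then have "x = f x \<otimes>\<^bsub>R\<^esub> g" using inj_onD[OF inj] x g(1) fJ[OF x] J.I_l_closed by metis
    then show "\<exists>r\<in>carrier R. x = r \<otimes>\<^bsub>R\<^esub> g" using fJ[OF x] by blast
  next
    fix r assume r: "r \<in> carrier R" "r \<otimes>\<^bsub>R\<^esub> g = \<zero>\<^bsub>R\<^esub>"
    have "r = f (r \<otimes>\<^bsub>R\<^esub> g)" using fm[OF r(1) g(1)] g(2) r(1) by simp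
    also have "\<dots> = f (\<zero>\<^bsub>R\<^esub> \<otimes>\<^bsub>R\<^esub> g)" using r(2) J.Icarr[OF g(1)] by simp
    also have "\<dots> = \<zero>\<^bsub>R\<^esub>" using fm[OF zero_closed g(1)] g(2) by simp
    finally show "r = \<zero>\<^bsub>R\<^esub>" .
  qed (rule g(1))
next
  interpret cring R by fact
  interpret J: ideal J R by fact
  assume ?gen
  then obtain g where g: "g \<in> J" "\<And>x. x \<in> J \<Longrightarrow> \<exists>r\<in>carrier R. x = r \<otimes>\<^bsub>R\<^esub> g"
    and reg: "\<And>r. r \<in> carrier R \<Longrightarrow> r \<otimes>\<^bsub>R\<^esub> g = \<zero>\<^bsub>R\<^esub> \<Longrightarrow> r = \<zero>\<^bsub>R\<^esub>" by blast
  note gR = J.Icarr[OF g(1)]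
  have canc: "r = s" if "r \<in> carrier R" "s \<in> carrier R" "r \<otimes>\<^bsub>R\<^esub> g = s \<otimes>\<^bsub>R\<^esub> g" for r s
  proof -
    have "(r \<ominus>\<^bsub>R\<^esub> s) \<otimes>\<^bsub>R\<^esub> g = \<zero>\<^bsub>R\<^esub>"
      using that gR by (simp add: minus_eq l_distr l_minus r_neg)
    then have "r \<ominus>\<^bsub>R\<^esub> s = \<zero>\<^bsub>R\<^esub>" using that by (simp add: reg)
    then show ?thesis using that by simp
  qed
  define f where "f x = (THE r. r \<in> carrier R \<and> x = r \<otimes>\<^bsub>R\<^esub> g)" for x
  have f: "f (r \<otimes>\<^bsub>R\<^esub> g) = r" if "r \<in> carrier R" for r
    unfolding f_def using that canc by (intro the_equality) auto
  have fJ: "f x \<in> carrier R" "f x \<otimes>\<^bsub>R\<^esub> g = x" if x: "x \<in> J" for x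
  proof -
    obtain r where r: "r \<in> carrier R" "x = r \<otimes>\<^bsub>R\<^esub> g" using g(2)[OF x] by blast
    show "f x \<in> carrier R" "f x \<otimes>\<^bsub>R\<^esub> g = x" using f[OF r(1)] r by simp_all
  qed
  have "f \<in> module_iso R (ideal_module R J) (ideal_module R (carrier R))"
    unfolding module_iso_def module_hom_def bij_betw_def
  proof (intro CollectI conjI ballI)
    show "f \<in> carrier (ideal_module R J) \<rightarrow> carrier (ideal_module R (carrier R))"
      using fJ(1) by (auto simp: ideal_module_def)
    fix x assume "x \<in> carrier (ideal_module R J)"
    then have x: "x \<in> J" by (simp add: ideal_module_def)
    show "f (x \<oplus>\<^bsub>ideal_module R J\<^esub> y) = f x \<oplus>\<^bsub>ideal_module R (carrier R)\<^esub> f y"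
      if "y \<in> carrier (ideal_module R J)" for y
    proof -
      from that have y: "y \<in> J" by (simp add: ideal_module_def)
      have "f ((f x \<oplus>\<^bsub>R\<^esub> f y) \<otimes>\<^bsub>R\<^esub> g) = f x \<oplus>\<^bsub>R\<^esub> f y"
        using fJ(1)[OF x] fJ(1)[OF y] by (intro f) simp
      then show ?thesis
        using fJ[OF x] fJ[OF y] gR by (simp add: ideal_module_def l_distr)
    qed
    show "f (a \<odot>\<^bsub>ideal_module R J\<^esub> x) = a \<odot>\<^bsub>ideal_module R (carrier R)\<^esub> f x" if a: "a \<in> carrier R" for a
    proof -
      have "f ((a \<otimes>\<^bsub>R\<^esub> f x) \<otimes>\<^bsub>R\<^esub> g) = a \<otimes>\<^bsub>R\<^esub> f x" using a fJ(1)[OF x] by (intro f) simp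
      then show ?thesis using a fJ[OF x] gR by (simp add: ideal_module_def m_assoc)
    qed
  next
    show "inj_on f (carrier (ideal_module R J))"
      using fJ(2) by (simp add: ideal_module_def) (metis inj_onI)
    show "f ` carrier (ideal_module R J) = carrier (ideal_module R (carrier R))"
    proof
      show "f ` carrier (ideal_module R J) \<subseteq> carrier (ideal_module R (carrier R))"
        using fJ(1) by (auto simp: ideal_module_def)
      show "carrier (ideal_module R (carrier R)) \<subseteq> f ` carrier (ideal_module R J)"
      proof
        fix r assume "r \<in> carrier (ideal_module R (carrier R))"
        then have r: "r \<in> carrier R" by (simp add: ideal_module_def)
        show "r \<in> f ` carrier (ideal_module R J)"
          using f[OF r] J.I_l_closed[OF g(1) r] by (intro image_eqI[of _ _ "r \<otimes>\<^bsub>R\<^esub> g"]) (simp_all add: ideal_module_def)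
      qed
    qed
  qed
  then show ?iso unfolding modules_isomorphic_def by blast
qed

text \<open>
  A generator \<open>a/s\<close> of the localized ideal may be replaced by \<open>a\<close> itself, as \<open>s\<close> is a unit. Clearing
  denominators then leaves a condition on elements of \<^term>\<open>R\<close>.
\<close>

lemma (in primeideal) localized_ideal_iso_iff:
  assumes "ideal J R"
  shows "modules_isomorphic (localization R I)
      (ideal_module (localization R I) (localized_ideal R I J))
      (ideal_module (localization R I) (carrier (localization R I))) \<longleftrightarrow>
    (\<exists>a\<in>J. (\<forall>b\<in>J. \<exists>u\<in>carrier R - I. \<exists>r\<in>carrier R. u \<otimes> b = r \<otimes> a) \<and>
      (\<forall>c\<in>carrier R. c \<otimes> a = \<zero> \<longrightarrow> (\<exists>u\<in>carrier R - I. u \<otimes> c = \<zero>)))"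
    (is "?iso \<longleftrightarrow> ?gen")
proof -
  let ?L = "localization R I"
  let ?F = "loc_frac R I"
  interpret L: cring ?L by (rule cring_localization)
  interpret J: ideal J R by fact
  have zero: "\<zero>\<^bsub>?L\<^esub> = ?F \<zero> \<one>" by (simp add: localization_def)
  note iff = ideal_module_iso_ring_iff[OF cring_localization ideal_localized_ideal[OF assms]]
  have locI: "?F a s \<in> localized_ideal R I J" if "a \<in> J" "s \<in> carrier R - I" for a s
    using that unfolding localized_ideal_eq[OF assms] by blast
  show ?thesis
    unfolding iff
  proof
    assume "\<exists>g\<in>localized_ideal R I J. (\<forall>x\<in>localized_ideal R I J. \<exists>r\<in>carrier ?L. x = r \<otimes>\<^bsub>?L\<^esub> g) \<and>
      (\<forall>r\<in>carrier ?L. r \<otimes>\<^bsub>?L\<^esub> g = \<zero>\<^bsub>?L\<^esub> \<longrightarrow> r = \<zero>\<^bsub>?L\<^esub>)"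
    then obtain g where g: "g \<in> localized_ideal R I J"
      and gr: "(\<forall>x\<in>localized_ideal R I J. \<exists>r\<in>carrier ?L. x = r \<otimes>\<^bsub>?L\<^esub> g) \<and>
        (\<forall>r\<in>carrier ?L. r \<otimes>\<^bsub>?L\<^esub> g = \<zero>\<^bsub>?L\<^esub> \<longrightarrow> r = \<zero>\<^bsub>?L\<^esub>)" by (rule bexE)
    note gen = gr[THEN conjunct1, THEN bspec] and reg = gr[THEN conjunct2, THEN bspec, THEN mp]
    obtain a s where a: "g = ?F a s" "a \<in> J" "s \<in> carrier R - I"
      using g unfolding localized_ideal_eq[OF assms] by blast
    note aR = J.Icarr[OF a(2)]
    show ?gen
    proof (rule bexI[of _ a], intro conjI ballI impI)
      fix b assume b: "b \<in> J"
      note bR = J.Icarr[OF b]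
      obtain x where x: "x \<in> carrier ?L" "?F b \<one> = x \<otimes>\<^bsub>?L\<^esub> g" using gen[OF locI[OF b denom_one]] by blast
      then obtain r t where r: "x = ?F r t" "r \<in> carrier R" "t \<in> carrier R - I" unfolding carrier_localization by blast
      have "?F b \<one> = ?F (r \<otimes> a) (t \<otimes> s)" using x(2) a r aR by (simp add: mult_frac)
      then obtain u where u: "u \<in> carrier R - I" "u \<otimes> (b \<otimes> (t \<otimes> s)) = u \<otimes> (r \<otimes> a \<otimes> \<one>)"
        using frac_eq_iff[of b \<one> "r \<otimes> a" "t \<otimes> s"] bR r aR a(3) denom_one denom_mult[OF r(3) a(3)] by auto
      have "(u \<otimes> (t \<otimes> s)) \<otimes> b = (u \<otimes> r) \<otimes> a"
        using u r a bR aR by (simp add: m_ac)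
      then show "\<exists>u\<in>carrier R - I. \<exists>r\<in>carrier R. u \<otimes> b = r \<otimes> a"
        using denom_mult[OF u(1) denom_mult[OF r(3) a(3)]] u(1) r(2) by blast
    next
      fix c assume c: "c \<in> carrier R" "c \<otimes> a = \<zero>"
      have "?F c \<one> \<otimes>\<^bsub>?L\<^esub> g = ?F \<zero> s" using c a aR denom_one by (simp add: mult_frac)
      also have "\<dots> = \<zero>\<^bsub>?L\<^esub>"
        unfolding zero using a(3) denom_one by (subst frac_zero_iff) auto
      finally have "?F c \<one> = ?F \<zero> \<one>" using reg[OF frac_closed[OF c(1) denom_one]] zero by simp
      then show "\<exists>u\<in>carrier R - I. u \<otimes> c = \<zero>" using frac_zero_iff[OF c(1) denom_one] by simp
    qed (rule a(2))
  next
    assume ?gen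
    then obtain a where a: "a \<in> J" and gen: "\<And>b. b \<in> J \<Longrightarrow> \<exists>u\<in>carrier R - I. \<exists>r\<in>carrier R. u \<otimes> b = r \<otimes> a"
      and reg: "\<And>c. c \<in> carrier R \<Longrightarrow> c \<otimes> a = \<zero> \<Longrightarrow> \<exists>u\<in>carrier R - I. u \<otimes> c = \<zero>" by blast
    note aR = J.Icarr[OF a]
    show "\<exists>g\<in>localized_ideal R I J. (\<forall>x\<in>localized_ideal R I J. \<exists>r\<in>carrier ?L. x = r \<otimes>\<^bsub>?L\<^esub> g) \<and>
      (\<forall>r\<in>carrier ?L. r \<otimes>\<^bsub>?L\<^esub> g = \<zero>\<^bsub>?L\<^esub> \<longrightarrow> r = \<zero>\<^bsub>?L\<^esub>)"
    proof (rule bexI[of _ "?F a \<one>"], intro conjI ballI impI)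
      fix x assume "x \<in> localized_ideal R I J"
      then obtain b s where x: "x = ?F b s" "b \<in> J" "s \<in> carrier R - I"
        unfolding localized_ideal_eq[OF assms] by blast
      note bR = J.Icarr[OF x(2)]
      obtain u r where u: "u \<in> carrier R - I" "r \<in> carrier R" "u \<otimes> b = r \<otimes> a" using gen[OF x(2)] by blast
      have "s \<otimes> (r \<otimes> a) = s \<otimes> (u \<otimes> b)" using u(3) by simp
      then have "b \<otimes> (u \<otimes> s) = r \<otimes> a \<otimes> s" using u(1,2) x(3) bR aR by (simp add: m_ac)
      then have "x = ?F (r \<otimes> a) (u \<otimes> s)"
        unfolding x(1) using u x(3) bR aR denom_mult[OF u(1) x(3)] denom_one
        by (subst frac_eq_iff) (auto intro!: bexI[of _ \<one>])
      also have "\<dots> = ?F r (u \<otimes> s) \<otimes>\<^bsub>?L\<^esub> ?F a \<one>"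
        using u x(3) aR denom_mult[OF u(1) x(3)] denom_one by (simp add: mult_frac)
      finally show "\<exists>r\<in>carrier ?L. x = r \<otimes>\<^bsub>?L\<^esub> ?F a \<one>"
        using frac_closed[OF u(2) denom_mult[OF u(1) x(3)]] by blast
    next
      fix x assume x: "x \<in> carrier ?L" "x \<otimes>\<^bsub>?L\<^esub> ?F a \<one> = \<zero>\<^bsub>?L\<^esub>"
      then obtain c s where c: "x = ?F c s" "c \<in> carrier R" "s \<in> carrier R - I" unfolding carrier_localization by blast
      have "?F (c \<otimes> a) s = ?F \<zero> \<one>" using x(2) c aR denom_one zero by (simp add: mult_frac)
      then obtain u where u: "u \<in> carrier R - I" "u \<otimes> (c \<otimes> a) = \<zero>" using frac_zero_iff[of "c \<otimes> a" s] c aR by auto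
      then have "(u \<otimes> c) \<otimes> a = \<zero>" using c aR by (simp add: m_assoc)
      then obtain v where v: "v \<in> carrier R - I" "v \<otimes> (u \<otimes> c) = \<zero>" using reg[of "u \<otimes> c"] u c by auto
      then have "(v \<otimes> u) \<otimes> c = \<zero>" using u c by (simp add: m_assoc)
      then show "x = \<zero>\<^bsub>?L\<^esub>"
        unfolding c(1) zero frac_zero_iff[OF c(2,3)] using denom_mult[OF v(1) u(1)] by blast
    qed (rule locI[OF a denom_one])
  qed
qed

section \<open>Pairings and cogeneration by a Hom module\<close>

lemma module_homD:
  assumes "f \<in> module_hom R M N"
  shows "x \<in> carrier M \<Longrightarrow> f x \<in> carrier N"
    "x \<in> carrier M \<Longrightarrow> y \<in> carrier M \<Longrightarrow> f (x \<oplus>\<^bsub>M\<^esub> y) = f x \<oplus>\<^bsub>N\<^esub> f y"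
    "a \<in> carrier R \<Longrightarrow> x \<in> carrier M \<Longrightarrow> f (a \<odot>\<^bsub>M\<^esub> x) = a \<odot>\<^bsub>N\<^esub> f x"
  using assms unfolding module_hom_def by auto

lemma module_hom_zero:
  assumes "module R M" "module R N" "f \<in> module_hom R M N"
  shows "f \<zero>\<^bsub>M\<^esub> = \<zero>\<^bsub>N\<^esub>"
proof -
  interpret M: module R M by fact
  interpret N: module R N by fact
  have "f (\<zero>\<^bsub>R\<^esub> \<odot>\<^bsub>M\<^esub> \<zero>\<^bsub>M\<^esub>) = \<zero>\<^bsub>R\<^esub> \<odot>\<^bsub>N\<^esub> f \<zero>\<^bsub>M\<^esub>"
    by (rule module_homD(3)[OF assms(3)]) simp_all
  then show ?thesis using module_homD(1)[OF assms(3), of "\<zero>\<^bsub>M\<^esub>"] by simp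
qed

definition bilinear_pairing ::
    "('r, 'x) ring_scheme \<Rightarrow> ('r, 'm, 'y) module_scheme \<Rightarrow> ('r, 'n, 'z) module_scheme \<Rightarrow>
      ('r, 'q, 'w) module_scheme \<Rightarrow> ('m \<Rightarrow> 'n \<Rightarrow> 'q) \<Rightarrow> bool"
  where "bilinear_pairing R M N Q g \<longleftrightarrow>
    (\<forall>x\<in>carrier M. g x \<in> module_hom R N Q) \<and>
    (\<forall>y\<in>carrier N. (\<lambda>x. g x y) \<in> module_hom R M Q)"

lemma bilinear_pairingD:
  assumes "bilinear_pairing R M N Q g"
  shows "x \<in> carrier M \<Longrightarrow> g x \<in> module_hom R N Q"
    "y \<in> carrier N \<Longrightarrow> (\<lambda>x. g x y) \<in> module_hom R M Q"
  using assms unfolding bilinear_pairing_def by auto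

text \<open>
  The coordinates of a monomorphism into a power of \<open>Hom(N, Q)\<close> are pairings, by currying. Conversely,
  choosing for every nonzero \<open>x\<close> a pairing that detects it gives a monomorphism into the power indexed
  by the nonzero elements of \<^term>\<open>M\<close>.
\<close>

lemma cogenerated_class_hom_module_iff:
  fixes M :: "('r, 'm) module" and U :: "'u itself"
  assumes M: "module R M" and N: "module R N" and Q: "module R Q"
  shows "M \<in> cogenerated_class U R (hom_module R N Q) \<longleftrightarrow>
    (\<forall>x\<in>carrier M. x \<noteq> \<zero>\<^bsub>M\<^esub> \<longrightarrow>
      (\<exists>g. bilinear_pairing R M N Q g \<and> (\<exists>y\<in>carrier N. g x y \<noteq> \<zero>\<^bsub>Q\<^esub>)))"
    (is "?cog \<longleftrightarrow> ?sep")
proof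
  interpret M: module R M by fact
  interpret N: module R N by fact
  interpret Q: module R Q by fact
  let ?C = "hom_module R N Q"
  assume ?cog
  then obtain L :: "('m + 'u) set" and F where F: "F \<in> module_mono R M (power_module L ?C)"
    unfolding cogenerated_class_def by blast
  then have Fh: "F \<in> module_hom R M (power_module L ?C)" and inj: "inj_on F (carrier M)"
    by (auto simp: module_mono_def)
  have FL: "F x \<in> L \<rightarrow>\<^sub>E carrier ?C" if "x \<in> carrier M" for x
    using module_homD(1)[OF Fh that] by (simp add: power_module_def)
  have FC: "F x i \<in> module_hom R N Q" "F x i \<in> extensional (carrier N)" if "x \<in> carrier M" "i \<in> L" for x i
    using PiE_mem[OF FL[OF that(1)] that(2)] by (auto simp: hom_module_def)
  have pairing: "bilinear_pairing R M N Q (\<lambda>x. F x i)" if i: "i \<in> L" for i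
    unfolding bilinear_pairing_def
  proof (intro conjI ballI)
    show "F x i \<in> module_hom R N Q" if "x \<in> carrier M" for x using FC(1)[OF that i] .
    fix y assume y: "y \<in> carrier N"
    have "F (x \<oplus>\<^bsub>M\<^esub> x') i y = F x i y \<oplus>\<^bsub>Q\<^esub> F x' i y" if "x \<in> carrier M" "x' \<in> carrier M" for x x'
      using module_homD(2)[OF Fh that] y i by (simp add: power_module_def hom_module_def)
    moreover have "F (a \<odot>\<^bsub>M\<^esub> x) i y = a \<odot>\<^bsub>Q\<^esub> F x i y" if "a \<in> carrier R" "x \<in> carrier M" for a x
      using module_homD(3)[OF Fh that] y i by (simp add: power_module_def hom_module_def)
    ultimately show "(\<lambda>x. F x i y) \<in> module_hom R M Q"
      using module_homD(1)[OF FC(1)[OF _ i] y] unfolding module_hom_def by simp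
  qed
  show ?sep
  proof (intro ballI impI)
    fix x assume x: "x \<in> carrier M" "x \<noteq> \<zero>\<^bsub>M\<^esub>"
    have "F x \<noteq> F \<zero>\<^bsub>M\<^esub>" using inj_onD[OF inj _ x(1)] x(2) by auto
    then obtain i where i: "i \<in> L" "F x i \<noteq> F \<zero>\<^bsub>M\<^esub> i"
      using PiE_ext[OF FL[OF x(1)] FL[OF M.M.zero_closed]] by blast
    then obtain y where y: "y \<in> carrier N" "F x i y \<noteq> F \<zero>\<^bsub>M\<^esub> i y"
      using extensionalityI[OF FC(2)[OF x(1) i(1)] FC(2)[OF M.M.zero_closed i(1)]] by blast
    have "(\<lambda>x. F x i y) \<in> module_hom R M Q"
      using pairing[OF i(1)] y(1) unfolding bilinear_pairing_def by blast
    from module_hom_zero[OF M Q this] y(2) have "F x i y \<noteq> \<zero>\<^bsub>Q\<^esub>" by simp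
    with pairing[OF i(1)] y(1)
    show "\<exists>g. bilinear_pairing R M N Q g \<and> (\<exists>y\<in>carrier N. g x y \<noteq> \<zero>\<^bsub>Q\<^esub>)" by blast
  qed
next
  interpret M: module R M by fact
  interpret N: module R N by fact
  interpret Q: module R Q by fact
  let ?C = "hom_module R N Q"
  assume ?sep
  then obtain g where g: "\<And>x. x \<in> carrier M \<Longrightarrow> x \<noteq> \<zero>\<^bsub>M\<^esub> \<Longrightarrow>
      bilinear_pairing R M N Q (g x) \<and> (\<exists>y\<in>carrier N. g x x y \<noteq> \<zero>\<^bsub>Q\<^esub>)"
    by metis
  let ?L = "Inl ` (carrier M - {\<zero>\<^bsub>M\<^esub>}) :: ('m + 'u) set"
  define F where "F x = (\<lambda>i\<in>?L. \<lambda>y\<in>carrier N. g (projl i) x y)" for x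
  have gi: "bilinear_pairing R M N Q (g (projl i))" if i: "i \<in> ?L" for i
  proof -
    from i obtain x where x: "i = Inl x" "x \<in> carrier M" "x \<noteq> \<zero>\<^bsub>M\<^esub>" by blast
    then show ?thesis using g[OF x(2,3)] by simp
  qed
  have ghom: "g (projl i) x \<in> module_hom R N Q" if "i \<in> ?L" "x \<in> carrier M" for i x
    using gi[OF that(1)] that(2) unfolding bilinear_pairing_def by blast
  have ghom': "(\<lambda>x. g (projl i) x y) \<in> module_hom R M Q" if "i \<in> ?L" "y \<in> carrier N" for i y
    using gi[OF that(1)] that(2) unfolding bilinear_pairing_def by blast
  have Fhom: "F \<in> module_hom R M (power_module ?L ?C)"
    unfolding module_hom_def
  proof (intro CollectI conjI ballI funcsetI)
    fix x assume x: "x \<in> carrier M"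
    have "(\<lambda>y\<in>carrier N. g (projl i) x y) \<in> carrier ?C" if i: "i \<in> ?L" for i
      using module_homD[OF ghom[OF i x]] by (simp add: hom_module_def module_hom_def)
    then show "F x \<in> carrier (power_module ?L ?C)"
      unfolding F_def power_module_def by simp
    show "F (x \<oplus>\<^bsub>M\<^esub> x') = F x \<oplus>\<^bsub>power_module ?L ?C\<^esub> F x'" if x': "x' \<in> carrier M" for x'
      using module_homD(2)[OF ghom' x x']
      by (simp add: F_def power_module_def hom_module_def restrict_def fun_eq_iff)
    show "F (a \<odot>\<^bsub>M\<^esub> x) = a \<odot>\<^bsub>power_module ?L ?C\<^esub> F x" if a: "a \<in> carrier R" for a
      using module_homD(3)[OF ghom' a x]
      by (simp add: F_def power_module_def hom_module_def restrict_def fun_eq_iff)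
  qed
  have "inj_on F (carrier M)"
  proof (rule inj_onI, rule ccontr)
    fix x x' assume x: "x \<in> carrier M" "x' \<in> carrier M" "F x = F x'" "x \<noteq> x'"
    let ?d = "x \<ominus>\<^bsub>M\<^esub> x'"
    have d: "?d \<in> carrier M" "?d \<noteq> \<zero>\<^bsub>M\<^esub>" "?d \<oplus>\<^bsub>M\<^esub> x' = x"
      using x by (simp_all add: M.M.minus_eq M.M.a_assoc M.M.l_neg)
        (metis M.M.minus_equality M.M.minus_minus M.M.a_inv_closed)
    obtain y where y: "y \<in> carrier N" "g ?d ?d y \<noteq> \<zero>\<^bsub>Q\<^esub>" using g[OF d(1,2)] by blast
    have i: "Inl ?d \<in> ?L" using d(1,2) by blast
    have h: "(\<lambda>x. g ?d x y) \<in> module_hom R M Q" using ghom'[OF i y(1)] by simp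
    have "g ?d x y = g ?d x' y"
      using fun_cong[OF fun_cong[OF x(3), of "Inl ?d"], of y] i y(1) by (simp add: F_def)
    then have "g ?d ?d y \<oplus>\<^bsub>Q\<^esub> g ?d x' y = g ?d x' y"
      using module_homD(2)[OF h d(1) x(2)] d(3) by simp
    then show False
      using y(2) module_homD(1)[OF h d(1)] module_homD(1)[OF h x(2)] by simp
  qed
  with Fhom have "module_mono R M (power_module ?L ?C) \<noteq> {}" by (auto simp: module_mono_def)
  then show ?cog using M unfolding cogenerated_class_def by blast
qed

section \<open>From pairings to regular generators and back\<close>

text \<open>
  Injectivity of \<^term>\<open>N\<close> divides \<^term>\<open>x\<close> by any element of \<^term>\<open>R\<close> that violates the conclusion, and
  bilinearity turns this division into \<open>g(x, a) = 0\<close>.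
\<close>

lemma pairing_imp_locally_free:
  assumes inj: "injective_module U R N" and E: "module R E" and I: "ideal I R"
    and x: "x \<in> carrier N"
    and g: "bilinear_pairing R N (ideal_module R I) E g" and a: "a \<in> I" and nz: "g x a \<noteq> \<zero>\<^bsub>E\<^esub>"
  defines "P \<equiv> annihilator R N x"
  shows "\<forall>b\<in>I. \<exists>u\<in>carrier R - P. \<exists>r\<in>carrier R. u \<otimes>\<^bsub>R\<^esub> b = r \<otimes>\<^bsub>R\<^esub> a"
    and "\<forall>c\<in>carrier R. c \<otimes>\<^bsub>R\<^esub> a = \<zero>\<^bsub>R\<^esub> \<longrightarrow> (\<exists>u\<in>carrier R - P. u \<otimes>\<^bsub>R\<^esub> c = \<zero>\<^bsub>R\<^esub>)"
proof -
  have N: "module R N" using inj by (simp add: injective_module_def)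
  interpret N: module R N by fact
  interpret E: module R E by fact
  interpret I: ideal I R by fact
  have cr: "cring R" by unfold_locales
  note M = module_ideal_module[OF cr I]
  have g1: "g (c \<odot>\<^bsub>N\<^esub> y) b = c \<odot>\<^bsub>E\<^esub> g y b" if "c \<in> carrier R" "y \<in> carrier N" "b \<in> I" for c y b
    using module_homD(3)[OF bilinear_pairingD(2)[OF g]] that by (simp add: ideal_module_def)
  have g2: "g y (c \<otimes>\<^bsub>R\<^esub> b) = c \<odot>\<^bsub>E\<^esub> g y b" if "c \<in> carrier R" "y \<in> carrier N" "b \<in> I" for c y b
    using module_homD(3)[OF bilinear_pairingD(1)[OF g]] that by (simp add: ideal_module_def)
  have g0: "g \<zero>\<^bsub>N\<^esub> b = \<zero>\<^bsub>E\<^esub>" if "b \<in> I" for b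
    using module_hom_zero[OF N E bilinear_pairingD(2)[OF g]] that by (simp add: ideal_module_def)
  have g0': "g y \<zero>\<^bsub>R\<^esub> = \<zero>\<^bsub>E\<^esub>" if "y \<in> carrier N" for y
    using module_hom_zero[OF M E bilinear_pairingD(1)[OF g that]] by (simp add: ideal_module_def)
  have P: "r \<odot>\<^bsub>N\<^esub> x = \<zero>\<^bsub>N\<^esub>" if "r \<in> carrier R" "\<not> r \<in> carrier R - P" for r
    using that by (simp add: P_def annihilator_def)
  note aR = I.Icarr[OF a]
  show "\<forall>b\<in>I. \<exists>u\<in>carrier R - P. \<exists>r\<in>carrier R. u \<otimes>\<^bsub>R\<^esub> b = r \<otimes>\<^bsub>R\<^esub> a"
  proof (rule ballI, rule ccontr)
    fix b assume b: "b \<in> I" and *: "\<not> (\<exists>u\<in>carrier R - P. \<exists>r\<in>carrier R. u \<otimes>\<^bsub>R\<^esub> b = r \<otimes>\<^bsub>R\<^esub> a)"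
    note bR = I.Icarr[OF b]
    have "\<exists>y\<in>carrier N. a \<odot>\<^bsub>N\<^esub> y = \<zero>\<^bsub>N\<^esub> \<and> b \<odot>\<^bsub>N\<^esub> y = x"
      by (rule injective_module_solve[OF inj x aR bR]) (use * P in blast)
    then obtain y where y: "y \<in> carrier N" "a \<odot>\<^bsub>N\<^esub> y = \<zero>\<^bsub>N\<^esub>" "b \<odot>\<^bsub>N\<^esub> y = x" by blast
    have "g x a = b \<odot>\<^bsub>E\<^esub> g y a" using g1[OF bR y(1) a] y(3) by simp
    also have "\<dots> = g y (b \<otimes>\<^bsub>R\<^esub> a)" using g2[OF bR y(1) a] by simp
    also have "\<dots> = g y (a \<otimes>\<^bsub>R\<^esub> b)" using aR bR by (simp add: N.R.m_comm)
    also have "\<dots> = a \<odot>\<^bsub>E\<^esub> g y b" using g2[OF aR y(1) b] by simp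
    also have "\<dots> = g \<zero>\<^bsub>N\<^esub> b" using g1[OF aR y(1) b] y(2) by simp
    finally show False using g0[OF b] nz by simp
  qed
  show "\<forall>c\<in>carrier R. c \<otimes>\<^bsub>R\<^esub> a = \<zero>\<^bsub>R\<^esub> \<longrightarrow> (\<exists>u\<in>carrier R - P. u \<otimes>\<^bsub>R\<^esub> c = \<zero>\<^bsub>R\<^esub>)"
  proof (intro ballI impI, rule ccontr)
    fix c assume c: "c \<in> carrier R" "c \<otimes>\<^bsub>R\<^esub> a = \<zero>\<^bsub>R\<^esub>" and *: "\<not> (\<exists>u\<in>carrier R - P. u \<otimes>\<^bsub>R\<^esub> c = \<zero>\<^bsub>R\<^esub>)"
    \<comment> \<open>Only division by \<open>c\<close> is wanted here, so the second equation is made void by the coefficient \<open>0\<close>.\<close>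
    have "\<exists>y\<in>carrier N. \<zero>\<^bsub>R\<^esub> \<odot>\<^bsub>N\<^esub> y = \<zero>\<^bsub>N\<^esub> \<and> c \<odot>\<^bsub>N\<^esub> y = x"
    proof (rule injective_module_solve[OF inj x N.R.zero_closed c(1)])
      fix r s assume "r \<in> carrier R" "s \<in> carrier R" "r \<otimes>\<^bsub>R\<^esub> c = s \<otimes>\<^bsub>R\<^esub> \<zero>\<^bsub>R\<^esub>"
      then show "r \<odot>\<^bsub>N\<^esub> x = \<zero>\<^bsub>N\<^esub>" using * by (intro P) auto
    qed
    then obtain y where y: "y \<in> carrier N" "c \<odot>\<^bsub>N\<^esub> y = x" by blast
    have "g x a = g y (c \<otimes>\<^bsub>R\<^esub> a)" using g1[OF c(1) y(1) a] g2[OF c(1) y(1) a] y(2) by simp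
    then show False using g0'[OF y(1)] c(2) nz by simp
  qed
qed

text \<open>The element is the image of \<open>1\<close> under the embedding of the residue field.\<close>

lemma injective_hull_residue_socle:
  assumes R: "local_ring R \<mm>" and hull: "injective_hull U R (quotient_module R \<mm>) E"
  shows "\<exists>k\<in>carrier E. k \<noteq> \<zero>\<^bsub>E\<^esub> \<and> (\<forall>r\<in>\<mm>. r \<odot>\<^bsub>E\<^esub> k = \<zero>\<^bsub>E\<^esub>)"
proof -
  have "module R E" using hull by (simp add: injective_hull_def injective_module_def)
  then interpret E: module R E .
  have "maximalideal \<mm> R" using R unfolding local_ring_def by blast
  then interpret m: maximalideal \<mm> R .
  let ?Q = "quotient_module R \<mm>"
  obtain i where i: "i \<in> module_hom R ?Q E" "inj_on i (carrier ?Q)"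
    using hull unfolding injective_hull_def module_mono_def by blast
  let ?q = "\<lambda>r. \<mm> +>\<^bsub>R\<^esub> r"
  have q: "?q r \<in> carrier ?Q" if "r \<in> carrier R" for r
    using that by (auto simp: quotient_module_def FactRing_def A_RCOSETS_def')
  have act: "r \<odot>\<^bsub>?Q\<^esub> ?q s = ?q (r \<otimes>\<^bsub>R\<^esub> s)" if "r \<in> carrier R" "s \<in> carrier R" for r s
    using m.rcoset_mult_add[OF that] by (simp add: quotient_module_def FactRing_def)
  let ?k = "i (?q \<one>\<^bsub>R\<^esub>)"
  have k: "?k \<in> carrier E" using module_homD(1)[OF i(1) q] by simp
  have ik: "i (?q r) = r \<odot>\<^bsub>E\<^esub> ?k" if r: "r \<in> carrier R" for r
    using module_homD(3)[OF i(1) r q[OF E.R.one_closed]] act[OF r E.R.one_closed] r by simp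
  have q0: "?q r = ?q \<zero>\<^bsub>R\<^esub>" if "r \<in> \<mm>" for r
    using that by (simp add: m.a_rcos_const)
  show ?thesis
  proof (intro bexI[of _ ?k] conjI ballI)
    show "r \<odot>\<^bsub>E\<^esub> ?k = \<zero>\<^bsub>E\<^esub>" if r: "r \<in> \<mm>" for r
      using ik[OF m.Icarr[OF r]] ik[OF E.R.zero_closed] q0[OF r] k by simp
    show "?k \<noteq> \<zero>\<^bsub>E\<^esub>"
    proof
      assume "?k = \<zero>\<^bsub>E\<^esub>"
      then have "i (?q \<one>\<^bsub>R\<^esub>) = i (?q \<zero>\<^bsub>R\<^esub>)" using ik[OF E.R.zero_closed] k by simp
      then have "?q \<one>\<^bsub>R\<^esub> = ?q \<zero>\<^bsub>R\<^esub>" using inj_onD[OF i(2) _ q q] by simp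
      then have "\<one>\<^bsub>R\<^esub> \<in> \<mm>"
        using m.a_rcos_self[OF E.R.one_closed] q0 m.a_rcos_const[OF m.zero_closed] by metis
      then show False using m.one_imp_carrier m.I_notcarr by simp
    qed
  qed (rule k)
qed

text \<open>
  The multipliers of finitely many generators of \<^term>\<open>I\<close> have a product outside the prime ideal
  \<^term>\<open>P\<close>, and the elements that this product moves into \<open>R a\<close> form an ideal.
\<close>

lemma common_multiplier:
  assumes "noetherian_ring R" and P: "primeideal P R" and I: "ideal I R" and a: "a \<in> carrier R"
    and gen: "\<forall>b\<in>I. \<exists>u\<in>carrier R - P. \<exists>r\<in>carrier R. u \<otimes>\<^bsub>R\<^esub> b = r \<otimes>\<^bsub>R\<^esub> a"
  shows "\<exists>u\<in>carrier R - P. \<forall>b\<in>I. \<exists>r\<in>carrier R. u \<otimes>\<^bsub>R\<^esub> b = r \<otimes>\<^bsub>R\<^esub> a"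
proof -
  interpret noetherian_ring R by fact
  interpret P: primeideal P R by fact
  interpret I: ideal I R by fact
  obtain A where A: "A \<subseteq> carrier R" "finite A" "I = Idl\<^bsub>R\<^esub> A" using finetely_gen[OF I] by blast
  have AI: "A \<subseteq> I" using genideal_self[OF A(1)] A(3) by simp
  have "\<exists>u\<in>carrier R - P. \<forall>b\<in>A. \<exists>r\<in>carrier R. u \<otimes>\<^bsub>R\<^esub> b = r \<otimes>\<^bsub>R\<^esub> a"
    using A(2) AI
  proof (induction A)
    case empty
    then show ?case using P.denom_one by blast
  next
    case (insert b A)
    then obtain u where u: "u \<in> carrier R - P" "\<And>b. b \<in> A \<Longrightarrow> \<exists>r\<in>carrier R. u \<otimes>\<^bsub>R\<^esub> b = r \<otimes>\<^bsub>R\<^esub> a" by auto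
    obtain v r where v: "v \<in> carrier R - P" "r \<in> carrier R" "v \<otimes>\<^bsub>R\<^esub> b = r \<otimes>\<^bsub>R\<^esub> a" using gen insert.prems by blast
    have "\<exists>r\<in>carrier R. (u \<otimes>\<^bsub>R\<^esub> v) \<otimes>\<^bsub>R\<^esub> c = r \<otimes>\<^bsub>R\<^esub> a" if c: "c \<in> insert b A" for c
    proof (cases "c = b")
      case True
      have "(u \<otimes>\<^bsub>R\<^esub> v) \<otimes>\<^bsub>R\<^esub> b = (u \<otimes>\<^bsub>R\<^esub> r) \<otimes>\<^bsub>R\<^esub> a"
        using u(1) v a I.Icarr[of b] insert.prems by (simp add: m_assoc)
      then show ?thesis using True u(1) v(2) by blast
    next
      case False
      then obtain s where s: "s \<in> carrier R" "u \<otimes>\<^bsub>R\<^esub> c = s \<otimes>\<^bsub>R\<^esub> a" using u(2) c by blast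
      have cR: "c \<in> carrier R" using c insert.prems I.Icarr by blast
      have "(u \<otimes>\<^bsub>R\<^esub> v) \<otimes>\<^bsub>R\<^esub> c = v \<otimes>\<^bsub>R\<^esub> (u \<otimes>\<^bsub>R\<^esub> c)" using u(1) v(1) cR by (simp add: P.m_ac)
      also have "\<dots> = (v \<otimes>\<^bsub>R\<^esub> s) \<otimes>\<^bsub>R\<^esub> a" using s v(1) a by (simp add: m_assoc)
      finally show ?thesis using v(1) s(1) by blast
    qed
    then show ?case using P.denom_mult[OF u(1) v(1)] by blast
  qed
  then obtain u where u: "u \<in> carrier R - P" "\<And>b. b \<in> A \<Longrightarrow> \<exists>r\<in>carrier R. u \<otimes>\<^bsub>R\<^esub> b = r \<otimes>\<^bsub>R\<^esub> a" by blast
  let ?J = "{b \<in> carrier R. \<exists>r\<in>carrier R. u \<otimes>\<^bsub>R\<^esub> b = r \<otimes>\<^bsub>R\<^esub> a}"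
  have uR: "u \<in> carrier R" using u(1) by simp
  have l_closed: "c \<otimes>\<^bsub>R\<^esub> b \<in> ?J" if b: "b \<in> ?J" and c: "c \<in> carrier R" for b c
  proof -
    from b obtain r where r: "b \<in> carrier R" "r \<in> carrier R" "u \<otimes>\<^bsub>R\<^esub> b = r \<otimes>\<^bsub>R\<^esub> a" by blast
    have "u \<otimes>\<^bsub>R\<^esub> (c \<otimes>\<^bsub>R\<^esub> b) = c \<otimes>\<^bsub>R\<^esub> (u \<otimes>\<^bsub>R\<^esub> b)" using uR c r(1) by (simp add: P.m_ac)
    also have "\<dots> = (c \<otimes>\<^bsub>R\<^esub> r) \<otimes>\<^bsub>R\<^esub> a" using r c a by (simp add: m_assoc)
    finally show ?thesis using c r by blast
  qed
  have "ideal ?J R"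
  proof (rule idealI[OF ring_axioms])
    show "subgroup ?J (add_monoid R)"
    proof (rule add.subgroupI)
      show "?J \<subseteq> carrier R" by blast
      have "\<zero>\<^bsub>R\<^esub> \<in> ?J" using uR a by (auto intro!: bexI[of _ "\<zero>\<^bsub>R\<^esub>"])
      then show "?J \<noteq> {}" by blast
      show "\<ominus>\<^bsub>R\<^esub> b \<in> ?J" if b: "b \<in> ?J" for b
        using l_closed[OF b, of "\<ominus>\<^bsub>R\<^esub> \<one>\<^bsub>R\<^esub>"] b by (simp add: l_minus)
      show "b \<oplus>\<^bsub>R\<^esub> c \<in> ?J" if bc: "b \<in> ?J" "c \<in> ?J" for b c
      proof -
        from bc obtain r s where rs: "b \<in> carrier R" "r \<in> carrier R" "u \<otimes>\<^bsub>R\<^esub> b = r \<otimes>\<^bsub>R\<^esub> a"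
          "c \<in> carrier R" "s \<in> carrier R" "u \<otimes>\<^bsub>R\<^esub> c = s \<otimes>\<^bsub>R\<^esub> a" by blast
        have "u \<otimes>\<^bsub>R\<^esub> (b \<oplus>\<^bsub>R\<^esub> c) = (r \<oplus>\<^bsub>R\<^esub> s) \<otimes>\<^bsub>R\<^esub> a" using rs uR a by (simp add: l_distr r_distr)
        then show ?thesis using rs by blast
      qed
    qed
    show "c \<otimes>\<^bsub>R\<^esub> b \<in> ?J" if "b \<in> ?J" "c \<in> carrier R" for b c by (rule l_closed[OF that])
    show "b \<otimes>\<^bsub>R\<^esub> c \<in> ?J" if b: "b \<in> ?J" and c: "c \<in> carrier R" for b c
    proof -
      have "b \<otimes>\<^bsub>R\<^esub> c = c \<otimes>\<^bsub>R\<^esub> b" using b c by (intro P.m_comm) auto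
      then show ?thesis using l_closed[OF b c] by simp
    qed
  qed
  moreover have "A \<subseteq> ?J" using A(1) u(2) by blast
  ultimately have "I \<subseteq> ?J" unfolding A(3) by (rule genideal_minimal)
  then show ?thesis using u(1) by blast
qed


text \<open>
  The pairing is \<open>g(x, b) = h(r x)\<close> with \<open>u b = r a\<close>, where \<open>u\<close> is a common multiplier for \<^term>\<open>I\<close> and
  \<open>h\<close> vanishes on the submodule \<open>T\<close> of the elements that die in the localization of \<^term>\<open>N\<close> at \<open>P\<close>. The
  pairing thus factors through that localization, which never has to be constructed.
\<close>

lemma locally_free_imp_pairing:
  assumes noeth: "noetherian_ring R" and loc: "local_ring R \<mm>"
    and hull: "injective_hull U R (quotient_module R \<mm>) E" and N: "module R N" and I: "ideal I R"
    and y: "y \<in> carrier N" and P: "primeideal (annihilator R N y) R"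
    and a: "a \<in> I"
    and gen: "\<forall>b\<in>I. \<exists>u\<in>carrier R - annihilator R N y. \<exists>r\<in>carrier R. u \<otimes>\<^bsub>R\<^esub> b = r \<otimes>\<^bsub>R\<^esub> a"
    and reg: "\<forall>c\<in>carrier R. c \<otimes>\<^bsub>R\<^esub> a = \<zero>\<^bsub>R\<^esub> \<longrightarrow> (\<exists>u\<in>carrier R - annihilator R N y. u \<otimes>\<^bsub>R\<^esub> c = \<zero>\<^bsub>R\<^esub>)"
  shows "\<exists>g. bilinear_pairing R N (ideal_module R I) E g \<and> g y a \<noteq> \<zero>\<^bsub>E\<^esub>"
proof -
  define P where "P = annihilator R N y"
  have inj: "injective_module U R E" using hull by (simp add: injective_hull_def)
  then have E: "module R E" by (simp add: injective_module_def)
  interpret N: module R N by fact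
  interpret E: module R E by fact
  interpret P: primeideal P R using P by (simp add: P_def)
  interpret I: ideal I R by fact
  have Pm: "P \<subseteq> \<mm>" by (rule prime_subset_maximal[OF noeth loc P.primeideal])
  have annP: "r \<in> P" if "r \<in> carrier R" "r \<odot>\<^bsub>N\<^esub> y = \<zero>\<^bsub>N\<^esub>" for r
    unfolding P_def annihilator_def by (intro CollectI conjI that)
  obtain k where "k \<in> carrier E" and "k \<noteq> \<zero>\<^bsub>E\<^esub> \<and> (\<forall>r\<in>\<mm>. r \<odot>\<^bsub>E\<^esub> k = \<zero>\<^bsub>E\<^esub>)"
    using injective_hull_residue_socle[OF loc hull] by (rule bexE)
  then have k: "k \<in> carrier E" "k \<noteq> \<zero>\<^bsub>E\<^esub>" "\<And>r. r \<in> \<mm> \<Longrightarrow> r \<odot>\<^bsub>E\<^esub> k = \<zero>\<^bsub>E\<^esub>"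
    by simp_all
  note aR = I.Icarr[OF a]
  obtain u where u: "u \<in> carrier R - P" and "\<forall>b\<in>I. \<exists>r\<in>carrier R. u \<otimes>\<^bsub>R\<^esub> b = r \<otimes>\<^bsub>R\<^esub> a"
    using common_multiplier[OF noeth P.primeideal I aR gen[folded P_def]] by (rule bexE)
  note mult = this(2)[THEN bspec]
  have uR: "u \<in> carrier R" using u by simp
  define T where "T = {x \<in> carrier N. \<exists>v\<in>carrier R - P. v \<odot>\<^bsub>N\<^esub> x = \<zero>\<^bsub>N\<^esub>}"
  have T0: "\<zero>\<^bsub>N\<^esub> \<in> T" using P.denom_one unfolding T_def by auto
  have Tsmult: "r \<odot>\<^bsub>N\<^esub> t \<in> T" if r: "r \<in> carrier R" and t: "t \<in> T" for r t
  proof -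
    from t obtain v where v: "t \<in> carrier N" "v \<in> carrier R - P" "v \<odot>\<^bsub>N\<^esub> t = \<zero>\<^bsub>N\<^esub>" by (auto simp: T_def)
    have "v \<odot>\<^bsub>N\<^esub> (r \<odot>\<^bsub>N\<^esub> t) = r \<odot>\<^bsub>N\<^esub> (v \<odot>\<^bsub>N\<^esub> t)"
      using v(1,2) r by (simp add: N.R.m_comm flip: N.smult_assoc1)
    then have "v \<odot>\<^bsub>N\<^esub> (r \<odot>\<^bsub>N\<^esub> t) = \<zero>\<^bsub>N\<^esub>" using v(3) r by simp
    then show ?thesis using v(1,2) r unfolding T_def by blast
  qed
  have Tadd: "t \<oplus>\<^bsub>N\<^esub> t' \<in> T" if t: "t \<in> T" "t' \<in> T" for t t'
  proof -
    from t obtain v v' where v: "t \<in> carrier N" "v \<in> carrier R - P" "v \<odot>\<^bsub>N\<^esub> t = \<zero>\<^bsub>N\<^esub>"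
      "t' \<in> carrier N" "v' \<in> carrier R - P" "v' \<odot>\<^bsub>N\<^esub> t' = \<zero>\<^bsub>N\<^esub>" by (auto simp: T_def)
    have "(v' \<otimes>\<^bsub>R\<^esub> v) \<odot>\<^bsub>N\<^esub> t = \<zero>\<^bsub>N\<^esub>" using v by (simp add: N.smult_assoc1)
    moreover have "(v' \<otimes>\<^bsub>R\<^esub> v) \<odot>\<^bsub>N\<^esub> t' = \<zero>\<^bsub>N\<^esub>"
      using v by (simp add: N.R.m_comm[of v' v] N.smult_assoc1)
    ultimately have "(v' \<otimes>\<^bsub>R\<^esub> v) \<odot>\<^bsub>N\<^esub> (t \<oplus>\<^bsub>N\<^esub> t') = \<zero>\<^bsub>N\<^esub>" using v by (simp add: N.smult_r_distr)
    then show ?thesis using P.denom_mult[OF v(5,2)] v(1,4) unfolding T_def by blast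
  qed
  have TN: "t \<in> carrier N" if "t \<in> T" for t using that by (simp add: T_def)
  \<comment> \<open>Since \<open>g(y, a) = h(u y)\<close>, it is \<open>u y\<close>, rather than \<open>y\<close>, that \<open>h\<close> has to send to \<open>k\<close>:
    \<open>u\<close> may lie in the maximal ideal, and then \<open>h(y) = k\<close> would give \<open>h(u y) = 0\<close>.\<close>
  define z where "z = u \<odot>\<^bsub>N\<^esub> y"
  have z: "z \<in> carrier N" using uR y by (simp add: z_def)
  \<comment> \<open>Elements of \<open>P\<close> kill \<open>k\<close>, so \<open>t + r z \<mapsto> r k\<close> for \<open>t\<close> in \<open>T\<close> is single-valued by this.\<close>
  have zT: "r \<in> P" if r: "r \<in> carrier R" "r \<odot>\<^bsub>N\<^esub> z \<in> T" for r
  proof -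
    from r(2) obtain v where v: "v \<in> carrier R - P" "v \<odot>\<^bsub>N\<^esub> (r \<odot>\<^bsub>N\<^esub> z) = \<zero>\<^bsub>N\<^esub>" by (auto simp: T_def)
    have "(v \<otimes>\<^bsub>R\<^esub> (r \<otimes>\<^bsub>R\<^esub> u)) \<odot>\<^bsub>N\<^esub> y = \<zero>\<^bsub>N\<^esub>"
      using v r(1) uR y by (simp add: z_def N.smult_assoc1)
    then have "v \<otimes>\<^bsub>R\<^esub> (r \<otimes>\<^bsub>R\<^esub> u) \<in> P" using v(1) r(1) uR by (intro annP) simp_all
    then have "r \<otimes>\<^bsub>R\<^esub> u \<in> P" using P.I_prime[of v "r \<otimes>\<^bsub>R\<^esub> u"] v(1) r(1) uR by blast
    then show ?thesis using P.I_prime[of r u] r(1) u by blast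
  qed
  define G where "G = {(t \<oplus>\<^bsub>N\<^esub> r \<odot>\<^bsub>N\<^esub> z, r \<odot>\<^bsub>E\<^esub> k) |t r. t \<in> T \<and> r \<in> carrier R}"
  have GI: "(p, q) \<in> G" if "t \<in> T" "r \<in> carrier R" "p = t \<oplus>\<^bsub>N\<^esub> r \<odot>\<^bsub>N\<^esub> z" "q = r \<odot>\<^bsub>E\<^esub> k" for p q t r
    using that unfolding G_def by blast
  have GE: "\<exists>t r. t \<in> T \<and> r \<in> carrier R \<and> p = t \<oplus>\<^bsub>N\<^esub> r \<odot>\<^bsub>N\<^esub> z \<and> q = r \<odot>\<^bsub>E\<^esub> k" if "(p, q) \<in> G" for p q
    using that unfolding G_def by blast
  have "linear_graph R N E G"
    unfolding linear_graph_def
  proof (intro conjI allI impI ballI)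
    show "G \<subseteq> carrier N \<times> carrier E" unfolding G_def using z k(1) by (auto simp: TN)
    show "(\<zero>\<^bsub>N\<^esub>, \<zero>\<^bsub>E\<^esub>) \<in> G" by (rule GI[OF T0 N.R.zero_closed]) (simp_all add: z k(1))
    fix p q assume "(p, q) \<in> G"
    then obtain t r where tr: "t \<in> T" "r \<in> carrier R" "p = t \<oplus>\<^bsub>N\<^esub> r \<odot>\<^bsub>N\<^esub> z" "q = r \<odot>\<^bsub>E\<^esub> k"
      using GE by blast
    show "(p \<oplus>\<^bsub>N\<^esub> p', q \<oplus>\<^bsub>E\<^esub> q') \<in> G" if "(p', q') \<in> G" for p' q'
    proof -
      from GE[OF that] obtain t' r' where tr': "t' \<in> T" "r' \<in> carrier R"
        "p' = t' \<oplus>\<^bsub>N\<^esub> r' \<odot>\<^bsub>N\<^esub> z" "q' = r' \<odot>\<^bsub>E\<^esub> k" by blast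
      show ?thesis
        by (rule GI[OF Tadd[OF tr(1) tr'(1)], of "r \<oplus>\<^bsub>R\<^esub> r'"])
          (use tr tr' TN[OF tr(1)] TN[OF tr'(1)] z k(1) in
            \<open>simp_all add: N.M.a_ac N.smult_l_distr E.smult_l_distr\<close>)
    qed
    show "(c \<odot>\<^bsub>N\<^esub> p, c \<odot>\<^bsub>E\<^esub> q) \<in> G" if c: "c \<in> carrier R" for c
      by (rule GI[OF Tsmult[OF c tr(1)], of "c \<otimes>\<^bsub>R\<^esub> r"])
        (use tr c TN[OF tr(1)] z k(1) in \<open>simp_all add: N.smult_r_distr N.smult_assoc1 E.smult_assoc1\<close>)
  next
    fix q assume "(\<zero>\<^bsub>N\<^esub>, q) \<in> G"
    then obtain t r where tr: "t \<in> T" "r \<in> carrier R" "\<zero>\<^bsub>N\<^esub> = t \<oplus>\<^bsub>N\<^esub> r \<odot>\<^bsub>N\<^esub> z" "q = r \<odot>\<^bsub>E\<^esub> k"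
      using GE by blast
    note tN = TN[OF tr(1)]
    have "r \<odot>\<^bsub>N\<^esub> z = \<ominus>\<^bsub>N\<^esub> t"
      using tr(2,3) tN z by (metis N.M.a_comm N.M.minus_equality N.smult_closed)
    also have "\<dots> = (\<ominus>\<^bsub>R\<^esub> \<one>\<^bsub>R\<^esub>) \<odot>\<^bsub>N\<^esub> t" using tN by (simp add: N.smult_l_minus)
    also have "\<dots> \<in> T" using tr(1) by (intro Tsmult) simp_all
    finally have "r \<in> P" by (rule zT[OF tr(2)])
    then show "q = \<zero>\<^bsub>E\<^esub>" unfolding tr(4) using k(3) Pm by blast
  qed
  from injective_module_extend_graph[OF inj N this]
  obtain h where h: "h \<in> module_hom R N E" and hgraph: "\<forall>(p, q)\<in>G. h p = q" by (rule bexE)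
  have hG: "h p = q" if "(p, q) \<in> G" for p q using bspec[OF hgraph that] by simp
  note hom = module_homD[OF h]
  have hT: "h t = \<zero>\<^bsub>E\<^esub>" if "t \<in> T" for t
    by (rule hG, rule GI[OF that N.R.zero_closed]) (simp_all add: TN[OF that] z k(1))
  have hz: "h z = k"
    by (rule hG, rule GI[OF T0 N.R.one_closed]) (simp_all add: z k(1))
  have indep: "h (r \<odot>\<^bsub>N\<^esub> x) = h (r' \<odot>\<^bsub>N\<^esub> x)"
    if x: "x \<in> carrier N" and r: "r \<in> carrier R" "r' \<in> carrier R" "r \<otimes>\<^bsub>R\<^esub> a = r' \<otimes>\<^bsub>R\<^esub> a" for x r r'
  proof -
    let ?d = "r \<ominus>\<^bsub>R\<^esub> r'"
    have d: "?d \<in> carrier R" "?d \<oplus>\<^bsub>R\<^esub> r' = r"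
      using r by (simp_all add: N.R.minus_eq N.R.a_assoc N.R.l_neg)
    have "?d \<otimes>\<^bsub>R\<^esub> a = \<zero>\<^bsub>R\<^esub>" using r aR by (simp add: N.R.minus_eq N.R.l_distr N.R.l_minus N.R.r_neg)
    then obtain v where v: "v \<in> carrier R - P" "v \<otimes>\<^bsub>R\<^esub> ?d = \<zero>\<^bsub>R\<^esub>"
      using reg d(1) unfolding P_def[symmetric] by blast
    have "v \<odot>\<^bsub>N\<^esub> (?d \<odot>\<^bsub>N\<^esub> x) = \<zero>\<^bsub>N\<^esub>" using v d(1) x by (simp flip: N.smult_assoc1)
    then have "?d \<odot>\<^bsub>N\<^esub> x \<in> T" unfolding T_def using v(1) d(1) x by blast
    then have "h (?d \<odot>\<^bsub>N\<^esub> x) = \<zero>\<^bsub>E\<^esub>" by (rule hT)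
    moreover have "r \<odot>\<^bsub>N\<^esub> x = ?d \<odot>\<^bsub>N\<^esub> x \<oplus>\<^bsub>N\<^esub> r' \<odot>\<^bsub>N\<^esub> x"
      using N.smult_l_distr[OF d(1) r(2) x] d(2) by simp
    ultimately show ?thesis
      using hom(2)[of "?d \<odot>\<^bsub>N\<^esub> x" "r' \<odot>\<^bsub>N\<^esub> x"] hom(1)[of "r' \<odot>\<^bsub>N\<^esub> x"] d(1) r(2) x by simp
  qed
  define g where "g x b = h ((SOME r. r \<in> carrier R \<and> u \<otimes>\<^bsub>R\<^esub> b = r \<otimes>\<^bsub>R\<^esub> a) \<odot>\<^bsub>N\<^esub> x)" for x b
  have g: "g x b = h (r \<odot>\<^bsub>N\<^esub> x)"
    if x: "x \<in> carrier N" and r: "r \<in> carrier R" "u \<otimes>\<^bsub>R\<^esub> b = r \<otimes>\<^bsub>R\<^esub> a" for x b r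
  proof -
    let ?s = "SOME r. r \<in> carrier R \<and> u \<otimes>\<^bsub>R\<^esub> b = r \<otimes>\<^bsub>R\<^esub> a"
    have s: "?s \<in> carrier R \<and> u \<otimes>\<^bsub>R\<^esub> b = ?s \<otimes>\<^bsub>R\<^esub> a" by (rule someI[of _ r]) (use r in simp)
    show ?thesis
      unfolding g_def by (rule indep[OF x]) (use s r in simp_all)
  qed
  have "bilinear_pairing R N (ideal_module R I) E g"
    unfolding bilinear_pairing_def module_hom_def
  proof (intro conjI ballI CollectI funcsetI)
    fix x b assume x: "x \<in> carrier N" and "b \<in> carrier (ideal_module R I)"
    then have b: "b \<in> I" by (simp add: ideal_module_def)
    obtain r where r: "r \<in> carrier R" "u \<otimes>\<^bsub>R\<^esub> b = r \<otimes>\<^bsub>R\<^esub> a" using mult[OF b] by blast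
    show "g x b \<in> carrier E" unfolding g[OF x r] using hom(1) r(1) x by simp
    show "g x (b \<oplus>\<^bsub>ideal_module R I\<^esub> b') = g x b \<oplus>\<^bsub>E\<^esub> g x b'" if "b' \<in> carrier (ideal_module R I)" for b'
    proof -
      have b': "b' \<in> I" using that by (simp add: ideal_module_def)
      obtain r' where r': "r' \<in> carrier R" "u \<otimes>\<^bsub>R\<^esub> b' = r' \<otimes>\<^bsub>R\<^esub> a" using mult[OF b'] by blast
      have "u \<otimes>\<^bsub>R\<^esub> (b \<oplus>\<^bsub>R\<^esub> b') = (r \<oplus>\<^bsub>R\<^esub> r') \<otimes>\<^bsub>R\<^esub> a"
        using r r' uR aR I.Icarr[OF b] I.Icarr[OF b'] by (simp add: N.R.l_distr N.R.r_distr)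
      then have "g x (b \<oplus>\<^bsub>R\<^esub> b') = h ((r \<oplus>\<^bsub>R\<^esub> r') \<odot>\<^bsub>N\<^esub> x)" using r(1) r'(1) by (intro g[OF x]) simp_all
      also have "\<dots> = h (r \<odot>\<^bsub>N\<^esub> x) \<oplus>\<^bsub>E\<^esub> h (r' \<odot>\<^bsub>N\<^esub> x)" using hom(2) r(1) r'(1) x by (simp add: N.smult_l_distr)
      finally show ?thesis using g[OF x r] g[OF x r'] by (simp add: ideal_module_def)
    qed
    show "g x (c \<odot>\<^bsub>ideal_module R I\<^esub> b) = c \<odot>\<^bsub>E\<^esub> g x b" if c: "c \<in> carrier R" for c
    proof -
      have "u \<otimes>\<^bsub>R\<^esub> (c \<otimes>\<^bsub>R\<^esub> b) = c \<otimes>\<^bsub>R\<^esub> (u \<otimes>\<^bsub>R\<^esub> b)" using uR c I.Icarr[OF b] by (simp add: N.R.m_lcomm)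
      also have "\<dots> = (c \<otimes>\<^bsub>R\<^esub> r) \<otimes>\<^bsub>R\<^esub> a" using r c aR by (simp add: N.R.m_assoc)
      finally have "g x (c \<otimes>\<^bsub>R\<^esub> b) = h ((c \<otimes>\<^bsub>R\<^esub> r) \<odot>\<^bsub>N\<^esub> x)" using r(1) c by (intro g[OF x]) simp_all
      also have "\<dots> = c \<odot>\<^bsub>E\<^esub> h (r \<odot>\<^bsub>N\<^esub> x)" using hom(3) r(1) c x by (simp add: N.smult_assoc1)
      finally show ?thesis using g[OF x r] by (simp add: ideal_module_def)
    qed
  next
    fix b assume "b \<in> carrier (ideal_module R I)"
    then have b: "b \<in> I" by (simp add: ideal_module_def)
    obtain r where r: "r \<in> carrier R" "u \<otimes>\<^bsub>R\<^esub> b = r \<otimes>\<^bsub>R\<^esub> a" using mult[OF b] by blast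
    fix x assume x: "x \<in> carrier N"
    show "g x b \<in> carrier E" unfolding g[OF x r] using hom(1) r(1) x by simp
    show "g (x \<oplus>\<^bsub>N\<^esub> x') b = g x b \<oplus>\<^bsub>E\<^esub> g x' b" if x': "x' \<in> carrier N" for x'
      using g[OF x r] g[OF x' r] g[OF N.M.a_closed[OF x x'] r] hom(2) r(1) x x' by (simp add: N.smult_r_distr)
    show "g (c \<odot>\<^bsub>N\<^esub> x) b = c \<odot>\<^bsub>E\<^esub> g x b" if c: "c \<in> carrier R" for c
    proof -
      have "r \<odot>\<^bsub>N\<^esub> (c \<odot>\<^bsub>N\<^esub> x) = c \<odot>\<^bsub>N\<^esub> (r \<odot>\<^bsub>N\<^esub> x)"
        using c r(1) x by (simp add: N.R.m_comm flip: N.smult_assoc1)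
      then show ?thesis
        using g[OF x r] g[OF N.smult_closed[OF c x] r] hom(3)[OF c, of "r \<odot>\<^bsub>N\<^esub> x"] r(1) x by simp
    qed
  qed
  moreover have "g y a = k" using g[OF y uR refl] hz by (simp add: z_def)
  ultimately show ?thesis using k(2) by blast
qed

section \<open>Injective modules cogenerated by the dual of an ideal\<close>

theorem mainTheorem4:
  fixes R :: "('r, 'x) ring_scheme"
    and \<mm> I :: "'r set"
    and E :: "('r, 'e) module"
    and N :: "('r, 'n) module"
  assumes "noetherian_ring R"
    and "local_ring R \<mm>"
    and "ideal I R"
    and "injective_hull TYPE('u) R (quotient_module R \<mm>) E"
    and "injective_module TYPE('u) R N"
  shows "N \<in> cogenerated_class TYPE('u) R (hom_module R (ideal_module R I) E) \<longleftrightarrow>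
    (\<forall>P\<in>Ass R N.
       modules_isomorphic (localization R P)
         (ideal_module (localization R P) (localized_ideal R P I))
         (ideal_module (localization R P) (carrier (localization R P))))"
    (is "?cog \<longleftrightarrow> (\<forall>P\<in>Ass R N. ?iso P)")
proof -
  have N: "module R N" using assms(5) by (simp add: injective_module_def)
  have E: "module R E" using assms(4) by (simp add: injective_hull_def injective_module_def)
  interpret N: module R N by fact
  interpret E: module R E by fact
  interpret I: ideal I R by fact
  have IM: "module R (ideal_module R I)"
    by (rule module_ideal_module[OF N.R.is_cring assms(3)])
  have carr: "carrier (ideal_module R I) = I" by (simp add: ideal_module_def)
  have cog: "?cog \<longleftrightarrow> (\<forall>x\<in>carrier N. x \<noteq> \<zero>\<^bsub>N\<^esub> \<longrightarrow>
      (\<exists>g. bilinear_pairing R N (ideal_module R I) E g \<and> (\<exists>a\<in>I. g x a \<noteq> \<zero>\<^bsub>E\<^esub>)))"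
    using cogenerated_class_hom_module_iff[OF N IM E, of "TYPE('u)"] unfolding carr .
  show ?thesis
    unfolding cog
  proof (intro iffI ballI impI)
    fix P
    assume sep: "\<forall>x\<in>carrier N. x \<noteq> \<zero>\<^bsub>N\<^esub> \<longrightarrow>
      (\<exists>g. bilinear_pairing R N (ideal_module R I) E g \<and> (\<exists>a\<in>I. g x a \<noteq> \<zero>\<^bsub>E\<^esub>))"
      and "P \<in> Ass R N"
    then obtain x where P: "primeideal P R" and x: "x \<in> carrier N" "P = annihilator R N x"
      unfolding Ass_def by blast
    interpret P: primeideal P R by fact
    have "x \<noteq> \<zero>\<^bsub>N\<^esub>"
    proof
      assume "x = \<zero>\<^bsub>N\<^esub>"
      then have "\<one>\<^bsub>R\<^esub> \<in> annihilator R N x" by (simp add: annihilator_def)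
      then show False using P.denom_one unfolding x(2) by (elim DiffE notE)
    qed
    then obtain g a where g: "bilinear_pairing R N (ideal_module R I) E g" "a \<in> I" "g x a \<noteq> \<zero>\<^bsub>E\<^esub>"
      using sep x(1) by blast
    show "?iso P"
      unfolding P.localized_ideal_iso_iff[OF assms(3)]
      by (rule bexI[OF _ g(2)],
          rule conjI[OF pairing_imp_locally_free[OF assms(5) E assms(3) x(1) g, folded x(2)]])
  next
    fix x
    assume iso: "\<forall>P\<in>Ass R N. ?iso P" and x: "x \<in> carrier N" "x \<noteq> \<zero>\<^bsub>N\<^esub>"
    obtain r where r: "r \<in> carrier R" "annihilator R N (r \<odot>\<^bsub>N\<^esub> x) \<in> Ass R N"
      using N.exists_associated_multiple[OF assms(1) x] by blast
    let ?y = "r \<odot>\<^bsub>N\<^esub> x"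
    have y: "?y \<in> carrier N" using r(1) x(1) by simp
    have P: "primeideal (annihilator R N ?y) R" using r(2) by (simp add: Ass_def)
    obtain a where a: "a \<in> I"
      and gr: "(\<forall>b\<in>I. \<exists>u\<in>carrier R - annihilator R N ?y. \<exists>r\<in>carrier R. u \<otimes>\<^bsub>R\<^esub> b = r \<otimes>\<^bsub>R\<^esub> a) \<and>
        (\<forall>c\<in>carrier R. c \<otimes>\<^bsub>R\<^esub> a = \<zero>\<^bsub>R\<^esub> \<longrightarrow> (\<exists>u\<in>carrier R - annihilator R N ?y. u \<otimes>\<^bsub>R\<^esub> c = \<zero>\<^bsub>R\<^esub>))"
      using bspec[OF iso r(2)] unfolding primeideal.localized_ideal_iso_iff[OF P assms(3)] by (rule bexE)
    obtain g where g: "bilinear_pairing R N (ideal_module R I) E g" "g ?y a \<noteq> \<zero>\<^bsub>E\<^esub>"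
      using locally_free_imp_pairing[OF assms(1,2,4) N assms(3) y P a conjunct1[OF gr] conjunct2[OF gr]] by blast
    have "g ?y a = r \<odot>\<^bsub>E\<^esub> g x a"
      using module_homD(3)[OF bilinear_pairingD(2)[OF g(1)] r(1) x(1)] a carr by simp
    then have "g x a \<noteq> \<zero>\<^bsub>E\<^esub>" using g(2) r(1) by auto
    then show "\<exists>g. bilinear_pairing R N (ideal_module R I) E g \<and> (\<exists>a\<in>I. g x a \<noteq> \<zero>\<^bsub>E\<^esub>)"
      using g(1) a by blast
  qed
qed

end
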